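(* Let $K$ be an infinite field, $n$ a positive integer, $S=K[x_1,\ldots,x_n]$, and $\mathfrak m=(x_1,\ldots,x_n)$. For any matroid $\Delta$ on $[n]=\{1,\ldots,n\}$ with Stanley-Reisner ideal $I_\Delta\subseteq S$, the ideal $I_\Delta S_{\mathfrak m}$ is a set-theoretic complete intersection in the localization $S_{\mathfrak m}$.
   Context: A simplicial complex $\Delta$ on $[n]$ is a nonempty collection of subsets of $[n]$ (called faces) such that $F\in\Delta$ and $G\subseteq F$ imply $G\in\Delta$. It is not required that every $\{i\}$ be a face. The facets of $\Delta$ are the faces that are maximal under inclusion. A simplicial complex $\Delta$ on $[n]$ is a matroid if for any two facets $F,G$ of $\Delta$ and any $i\in F$ there exists $j\in G$ such that $(F\setminus\{i\})\cup\{j\}$ is a facet of $\Delta$. The Stanley-Reisner ideal is $I_\Delta=(x_{i_1}\cdots x_{i_s} : \{i_1,\ldots,i_s\}\notin\Delta)\subseteq S$. An ideal $I$ of a ring $R$ is a set-theoretic complete intersection if there exist $f_1,\ldots,f_h\in R$, where $h=\operatorname{ht}(I)$ is the height of $I$, such that $\sqrt{(f_1,\ldots,f_h)}=\sqrt{I}$. *)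

theory Defs
  imports
    "HOL-Algebra.Algebra"
    "HOL-Algebra.Algebraic_Closure_Type"
    "HOL-Computational_Algebra.Fraction_Field"
    "HOL-Library.Poly_Mapping"
    "HOL-Library.Extended_Nat"
begin

definition simplicial_complex_on :: "nat \<Rightarrow> nat set set \<Rightarrow> bool" where
  "simplicial_complex_on n \<Delta> \<longleftrightarrow>
     \<Delta> \<noteq> {} \<and> \<Delta> \<subseteq> Pow {1..n} \<and> (\<forall>F\<in>\<Delta>. \<forall>G. G \<subseteq> F \<longrightarrow> G \<in> \<Delta>)"

definition facets :: "nat set set \<Rightarrow> nat set set" where
  "facets \<Delta> = {F \<in> \<Delta>. \<forall>G\<in>\<Delta>. F \<subseteq> G \<longrightarrow> G = F}"

definition matroid_on :: "nat \<Rightarrow> nat set set \<Rightarrow> bool" where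
  "matroid_on n \<Delta> \<longleftrightarrow> simplicial_complex_on n \<Delta> \<and>
     (\<forall>F\<in>facets \<Delta>. \<forall>G\<in>facets \<Delta>. \<forall>i\<in>F. \<exists>j\<in>G. (F - {i}) \<union> {j} \<in> facets \<Delta>)"

definition radical :: "('a, 'm) ring_scheme \<Rightarrow> 'a set \<Rightarrow> 'a set" where
  "radical R I = {a \<in> carrier R. \<exists>k::nat. a [^]\<^bsub>R\<^esub> k \<in> I}"

text \<open>
  Height of a prime as supremum of the lengths of strict chains of primes ending at it. For an
  improper ideal, \<open>ideal_height\<close> is \<open>\<infinity>\<close> (infimum of the empty set).
\<close>

definition prime_height :: "('a, 'm) ring_scheme \<Rightarrow> 'a set \<Rightarrow> enat" where
  "prime_height R P =
     Sup {enat m | m. \<exists>c :: nat \<Rightarrow> 'a set.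
       (\<forall>i\<le>m. primeideal (c i) R) \<and> (\<forall>i<m. c i \<subset> c (Suc i)) \<and> c m = P}"

definition ideal_height :: "('a, 'm) ring_scheme \<Rightarrow> 'a set \<Rightarrow> enat" where
  "ideal_height R I = Inf {prime_height R P | P. primeideal P R \<and> I \<subseteq> P}"

definition set_theoretic_complete_intersection ::
    "('a, 'm) ring_scheme \<Rightarrow> 'a set \<Rightarrow> bool" where
  "set_theoretic_complete_intersection R I \<longleftrightarrow> ideal I R \<and>
     (\<exists>(h::nat) (f :: nat \<Rightarrow> 'a). enat h = ideal_height R I \<and>
        f ` {1..h} \<subseteq> carrier R \<and> radical R (Idl\<^bsub>R\<^esub> (f ` {1..h})) = radical R I)"


text \<open>
  The polynomial ring $K[x_1,\ldots,x_n]$. An exponent vector is a finitely supported function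
  \<^typ>\<open>nat \<Rightarrow>\<^sub>0 nat\<close>, a polynomial a finitely supported function from exponent vectors to $K$
  (with the convolution product of \<^theory>\<open>HOL-Library.Poly_Mapping\<close>). That type has infinitely
  many variables; the carrier keeps those polynomials in which only $x_1,\ldots,x_n$ occur.
\<close>

type_synonym 'k mpoly = "(nat \<Rightarrow>\<^sub>0 nat) \<Rightarrow>\<^sub>0 'k"

definition mpoly_ring :: "nat \<Rightarrow> 'k::field mpoly ring" where
  "mpoly_ring n = ring_of_type_algebra
     \<lparr>carrier := {p. \<forall>m\<in>Poly_Mapping.keys p. Poly_Mapping.keys m \<subseteq> {1..n}}\<rparr>"

definition indet :: "nat \<Rightarrow> 'k::field mpoly" where
  "indet i = Poly_Mapping.single (Poly_Mapping.single i 1) 1"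

definition irrelevant_ideal :: "nat \<Rightarrow> 'k::field mpoly set" where
  "irrelevant_ideal n = Idl\<^bsub>mpoly_ring n\<^esub> (indet ` {1..n})"

definition stanley_reisner_ideal :: "nat \<Rightarrow> nat set set \<Rightarrow> 'k::field mpoly set" where
  "stanley_reisner_ideal n \<Delta> =
     Idl\<^bsub>mpoly_ring n\<^esub> {\<Prod>i\<in>F. indet i | F. F \<subseteq> {1..n} \<and> F \<notin> \<Delta>}"


text \<open>
  The localization $S_P$ of a domain $S$ at a prime ideal $P$, realized as the ring of fractions
  $a/b$ with $b \notin P$ inside a field of fractions. Here $S$ is a subring, with the type-class
  operations, of a domain given by a type, so that \<^typ>\<open>'a fract\<close> contains the fractions of $S$.
\<close>

definition localization_at :: "('a::idom) ring \<Rightarrow> 'a set \<Rightarrow> 'a fract ring" where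
  "localization_at S P = ring_of_type_algebra
     \<lparr>carrier := {Fract a b | a b. a \<in> carrier S \<and> b \<in> carrier S \<and> b \<notin> P}\<rparr>"

definition extended_ideal :: "('a::idom) ring \<Rightarrow> 'a set \<Rightarrow> 'a set \<Rightarrow> 'a fract set" where
  "extended_ideal S P I = Idl\<^bsub>localization_at S P\<^esub> ((\<lambda>a. Fract a 1) ` I)"

end

theory Submission
  imports Defs
begin

text \<open>
  The nullity of a set \<open>A\<close> of vertices is \<open>card A\<close> minus the rank of \<open>A\<close>. It is positive precisely on the
  nonfaces, and its largest value \<open>h\<close>, on \<open>{1..n}\<close>, is the number of vertices outside a facet.

  Let \<open>q\<^sub>k\<close>, for \<open>1 \<le> k \<le> h\<close>, be the sum of the squarefree monomials \<open>x\<^sub>U\<close> over all sets \<open>U\<close> that are minimal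
  among the sets of nullity \<open>k\<close>. These \<open>h\<close> polynomials generate the Stanley-Reisner ideal up to radical,
  already before localizing. Nullity is supermodular, so two different minimal sets \<open>U\<close> and \<open>V\<close> of nullity
  \<open>k\<close> have a union of larger nullity (\<open>nullity_union_minimal\<close>). Therefore \<open>q\<^sub>k x\<^sub>U\<close> is the sum of \<open>x\<^sub>U\<^sup>2\<close> and
  multiples of monomials \<open>x\<^sub>W\<close> with \<open>W\<close> of nullity larger than \<open>k\<close>, and descending induction on \<open>k\<close> puts all
  monomials of nonfaces into the radical of \<open>(q\<^sub>1, \<dots>, q\<^sub>h)\<close> (\<open>nonface_mem_radical\<close>). This is the argument
  of Schmitt and Vogel, applied to the flats of the dual matroid.

  It remains to see that the height is \<open>h\<close>. The minimal primes of the Stanley-Reisner ideal are the ideals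
  generated by the \<open>h\<close> variables outside a facet (\<open>prime_contains_variable_ideal\<close>). Such an ideal has
  height at least \<open>h\<close>, by dropping one variable after the other. For the other bound a chain of primes
  that ends at this ideal is continued up to the maximal ideal, by adding the remaining \<open>n - h\<close> variables
  one at a time; so it suffices that no chain of primes of the polynomial ring has more than \<open>n\<close> steps
  (\<open>polynomials_chain_length\<close>). The reason for this is that any \<open>n + 1\<close> polynomials are algebraically
  dependent, by counting monomials, while a relation between elements taken from the successive steps of a
  chain would put one of its coefficients, a nonzero constant, into the last prime of the chain.
\<close>

section \<open>The nullity of a matroid\<close>

text \<open>This is the size of \<open>A\<close> minus its rank, because the rank of \<open>A\<close> is the largest size of \<open>A \<inter> F\<close> for a
  facet \<open>F\<close>.\<close>

definition nullity :: "nat set set \<Rightarrow> nat set \<Rightarrow> nat" where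
  "nullity \<Delta> A = Min ((\<lambda>F. card (A - F)) ` facets \<Delta>)"

text \<open>For \<open>k = 1\<close> these are the circuits. In general they are the complements of the flats of corank \<open>k\<close>
  of the dual matroid.\<close>

definition minimal_of_nullity :: "nat \<Rightarrow> nat set set \<Rightarrow> nat \<Rightarrow> nat set set" where
  "minimal_of_nullity n \<Delta> k =
     {U. U \<subseteq> {1..n} \<and> nullity \<Delta> U = k \<and> (\<forall>V. V \<subset> U \<longrightarrow> nullity \<Delta> V < k)}"

locale matroid =
  fixes n :: nat and \<Delta> :: "nat set set"
  assumes matroid: "matroid_on n \<Delta>"
begin

lemma face_subset: "F \<in> \<Delta> \<Longrightarrow> F \<subseteq> {1..n}"
  using matroid by (auto simp: matroid_on_def simplicial_complex_on_def)

lemma face_mono: "F \<in> \<Delta> \<Longrightarrow> G \<subseteq> F \<Longrightarrow> G \<in> \<Delta>"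
  using matroid by (auto simp: matroid_on_def simplicial_complex_on_def)

lemma finite_faces: "finite \<Delta>"
  by (rule finite_subset[of _ "Pow {1..n}"]) (use face_subset in auto)

lemma facet_face: "F \<in> facets \<Delta> \<Longrightarrow> F \<in> \<Delta>"
  by (simp add: facets_def)

lemma finite_facets: "finite (facets \<Delta>)"
  by (rule finite_subset[OF _ finite_faces]) (use facet_face in auto)

lemma facet_subset: "F \<in> facets \<Delta> \<Longrightarrow> F \<subseteq> {1..n}"
  using facet_face face_subset by blast

lemma finite_facet: "F \<in> facets \<Delta> \<Longrightarrow> finite F"
  using facet_subset finite_subset by blast

lemma facet_maximal: "F \<in> facets \<Delta> \<Longrightarrow> G \<in> \<Delta> \<Longrightarrow> F \<subseteq> G \<Longrightarrow> G = F"
  by (simp add: facets_def)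

lemma face_in_facet:
  assumes "G \<in> \<Delta>"
  obtains F where "F \<in> facets \<Delta>" "G \<subseteq> F"
proof -
  obtain F where "F \<in> \<Delta>" "G \<subseteq> F" "\<And>H. H \<in> \<Delta> \<Longrightarrow> F \<subseteq> H \<Longrightarrow> H = F"
    using finite_has_maximal2[OF finite_faces assms] by metis
  then show ?thesis
    by (intro that[of F]) (auto simp: facets_def)
qed

lemma facets_nonempty: "facets \<Delta> \<noteq> {}"
proof -
  have "\<Delta> \<noteq> {}"
    using matroid by (simp add: matroid_on_def simplicial_complex_on_def)
  then show ?thesis
    using face_in_facet by blast
qed

lemma facet_exchange:
  assumes "F \<in> facets \<Delta>" "G \<in> facets \<Delta>" "i \<in> F" "i \<notin> G"
  obtains j where "j \<in> G" "j \<notin> F" "insert j (F - {i}) \<in> facets \<Delta>"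
proof -
  obtain j where j: "j \<in> G" "(F - {i}) \<union> {j} \<in> facets \<Delta>"
    using assms matroid unfolding matroid_on_def by blast
  have "j \<notin> F"
  proof
    assume "j \<in> F"
    then have "(F - {i}) \<union> {j} \<subseteq> F" by auto
    then have "F = (F - {i}) \<union> {j}"
      using facet_maximal[OF j(2) facet_face[OF assms(1)]] by blast
    then show False
      using assms j by auto
  qed
  with j that show ?thesis by auto
qed

text \<open>Replacing the elements of one facet that lie outside another, one at a time, by elements of
  the other one does not change the size, and can be done without touching a prescribed subset.\<close>

lemma facet_extension:
  assumes "F \<in> facets \<Delta>" "G \<in> facets \<Delta>" "I \<subseteq> F"
  shows "\<exists>H\<in>facets \<Delta>. I \<subseteq> H \<and> H \<subseteq> I \<union> G \<and> card H = card F"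
  using assms
proof (induction "card (F - (I \<union> G))" arbitrary: F)
  case 0
  then have "F \<subseteq> I \<union> G"
    using finite_facet by auto
  with 0 show ?case by auto
next
  case (Suc k)
  then obtain i where i: "i \<in> F" "i \<notin> I" "i \<notin> G"
    by (metis Diff_iff UnCI all_not_in_conv card.empty nat.distinct(1))
  obtain j where j: "j \<in> G" "j \<notin> F" "insert j (F - {i}) \<in> facets \<Delta>"
    using facet_exchange[OF Suc.prems(1,2) i(1,3)] by blast
  have fin: "finite F" using Suc.prems finite_facet by blast
  have "insert j (F - {i}) - (I \<union> G) = (F - (I \<union> G)) - {i}"
    using j by auto
  then have "card (insert j (F - {i}) - (I \<union> G)) = k"
    using Suc.hyps(2) i fin by simp
  moreover have "I \<subseteq> insert j (F - {i})"
    using Suc.prems(3) i by auto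
  moreover have "card (insert j (F - {i})) = card F"
    using card_Suc_Diff1[OF fin i(1)] j(2) fin by simp
  ultimately show ?case
    using Suc.hyps(1)[of "insert j (F - {i})"] j(3) Suc.prems(2) by auto
qed

lemma card_facets_eq:
  assumes "F \<in> facets \<Delta>" "G \<in> facets \<Delta>"
  shows "card F = card G"
proof -
  obtain H where "H \<in> facets \<Delta>" "H \<subseteq> G" "card H = card F"
    using facet_extension[OF assms, of "{}"] by auto
  with facet_maximal[OF \<open>H \<in> facets \<Delta>\<close> facet_face[OF assms(2)]] show ?thesis by auto
qed

lemma nullity_le: "F \<in> facets \<Delta> \<Longrightarrow> nullity \<Delta> A \<le> card (A - F)"
  unfolding nullity_def using finite_facets by (intro Min_le) auto

lemma nullity_attained:
  obtains F where "F \<in> facets \<Delta>" "nullity \<Delta> A = card (A - F)"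
proof -
  have "nullity \<Delta> A \<in> (\<lambda>F. card (A - F)) ` facets \<Delta>"
    unfolding nullity_def using finite_facets facets_nonempty by (intro Min_in) auto
  with that show ?thesis by auto
qed

lemma nullity_mono:
  assumes "A \<subseteq> B" "finite B"
  shows "nullity \<Delta> A \<le> nullity \<Delta> B"
proof -
  obtain F where F: "F \<in> facets \<Delta>" "nullity \<Delta> B = card (B - F)"
    by (rule nullity_attained)
  have "nullity \<Delta> A \<le> card (A - F)" using nullity_le F by blast
  also have "\<dots> \<le> card (B - F)" using assms by (intro card_mono) auto
  finally show ?thesis using F by simp
qed

lemma nullity_pos_iff:
  assumes "finite A"
  shows "0 < nullity \<Delta> A \<longleftrightarrow> A \<notin> \<Delta>"
proof -
  have "nullity \<Delta> A = 0 \<longleftrightarrow> (\<exists>F\<in>facets \<Delta>. card (A - F) = 0)"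
    by (metis le_zero_eq nullity_attained nullity_le)
  also have "\<dots> \<longleftrightarrow> (\<exists>F\<in>facets \<Delta>. A \<subseteq> F)"
    using assms by auto
  also have "\<dots> \<longleftrightarrow> A \<in> \<Delta>"
    by (meson face_in_facet face_mono facet_face)
  finally show ?thesis by auto
qed

lemma nullity_ground:
  assumes "F \<in> facets \<Delta>"
  shows "nullity \<Delta> {1..n} = card ({1..n} - F)"
proof -
  obtain G where G: "G \<in> facets \<Delta>" "nullity \<Delta> {1..n} = card ({1..n} - G)"
    by (rule nullity_attained)
  then show ?thesis
    using assms facet_subset card_facets_eq[OF assms G(1)]
    by (simp add: card_Diff_subset finite_facet)
qed

text \<open>A facet that is optimal for \<^term>\<open>A \<inter> B\<close> can be modified outside \<^term>\<open>A \<inter> B\<close> so as to become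
  optimal for \<^term>\<open>A \<union> B\<close> too. This facet attains both terms on the right and bounds both terms on
  the left, and for a single facet the two sides agree.\<close>

lemma nullity_supermodular:
  assumes "finite A" "finite B"
  shows "nullity \<Delta> A + nullity \<Delta> B \<le> nullity \<Delta> (A \<union> B) + nullity \<Delta> (A \<inter> B)"
proof -
  obtain F where F: "F \<in> facets \<Delta>" "nullity \<Delta> (A \<inter> B) = card (A \<inter> B - F)"
    by (rule nullity_attained)
  obtain G where G: "G \<in> facets \<Delta>" "nullity \<Delta> (A \<union> B) = card (A \<union> B - G)"
    by (rule nullity_attained)
  obtain H where H: "H \<in> facets \<Delta>" "F \<inter> (A \<inter> B) \<subseteq> H" "H \<subseteq> F \<inter> (A \<inter> B) \<union> G"
    using facet_extension[OF F(1) G(1), of "F \<inter> (A \<inter> B)"] by auto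
  have fin: "finite F" "finite G" "finite H" using F G H finite_facet by auto
  have "card (A \<inter> B - H) \<le> card (A \<inter> B - F)"
    using H assms by (intro card_mono) auto
  moreover have "card (A \<union> B - H) \<le> card (A \<union> B - G)"
  proof -
    \<comment> \<open>Both differences are compared through the parts of the equicardinal facets inside and
      outside the union.\<close>
    have "card (H - (A \<union> B)) \<le> card (G - (A \<union> B))"
      using H fin by (intro card_mono) auto
    moreover have "card H = card (H \<inter> (A \<union> B)) + card (H - (A \<union> B))"
      "card G = card (G \<inter> (A \<union> B)) + card (G - (A \<union> B))"
      using fin by (simp_all add: card_Int_Diff)
    moreover have "card (A \<union> B) = card (H \<inter> (A \<union> B)) + card (A \<union> B - H)"
      "card (A \<union> B) = card (G \<inter> (A \<union> B)) + card (A \<union> B - G)"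
      using assms by (metis Int_commute card_Int_Diff finite_Un)+
    ultimately show ?thesis
      using card_facets_eq[OF H(1) G(1)] by linarith
  qed
  moreover have "card (A - H) + card (B - H) = card (A \<union> B - H) + card (A \<inter> B - H)"
  proof -
    have "(A - H) \<union> (B - H) = A \<union> B - H" "(A - H) \<inter> (B - H) = A \<inter> B - H" by auto
    then show ?thesis using card_Un_Int[of "A - H" "B - H"] assms by simp
  qed
  moreover have "nullity \<Delta> A \<le> card (A - H)" "nullity \<Delta> B \<le> card (B - H)"
    using nullity_le H by auto
  ultimately show ?thesis using F G by linarith
qed

lemma contains_minimal_of_nullity:
  assumes "A \<subseteq> {1..n}"
  obtains U where "U \<in> minimal_of_nullity n \<Delta> (nullity \<Delta> A)" "U \<subseteq> A"
proof -
  have finA: "finite A" using assms finite_subset by blast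
  define Z where "Z = {V. V \<subseteq> A \<and> nullity \<Delta> V = nullity \<Delta> A}"
  have "finite Z" "A \<in> Z"
    using finA by (simp_all add: Z_def)
  then have "\<exists>U\<in>Z. U \<subseteq> A \<and> (\<forall>V\<in>Z. V \<subseteq> U \<longrightarrow> U = V)"
    by (rule finite_has_minimal2)
  then obtain U where U: "U \<in> Z" "U \<subseteq> A" "\<forall>V\<in>Z. V \<subseteq> U \<longrightarrow> U = V"
    by (elim bexE conjE)
  have "nullity \<Delta> V < nullity \<Delta> A" if "V \<subset> U" for V
  proof -
    have "nullity \<Delta> V \<le> nullity \<Delta> A"
      using that U(2) finA by (intro nullity_mono) auto
    moreover have "nullity \<Delta> V \<noteq> nullity \<Delta> A"
      using that U(2,3) by (auto simp: Z_def)
    ultimately show ?thesis by linarith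
  qed
  then have "U \<in> minimal_of_nullity n \<Delta> (nullity \<Delta> A)"
    using U(1,2) assms by (auto simp: minimal_of_nullity_def Z_def)
  then show ?thesis
    using U(2) by (rule that)
qed

text \<open>This is the property of the minimal sets on which everything rests: \<open>U \<inter> V\<close> is properly contained
  in one of the two sets and so has smaller nullity, which supermodularity makes up for on \<open>U \<union> V\<close>.\<close>

lemma nullity_union_minimal:
  assumes "U \<in> minimal_of_nullity n \<Delta> k" "V \<in> minimal_of_nullity n \<Delta> k" "U \<noteq> V"
  shows "k < nullity \<Delta> (U \<union> V)"
proof -
  have sub: "U \<subseteq> {1..n}" "V \<subseteq> {1..n}" and null: "nullity \<Delta> U = k" "nullity \<Delta> V = k"
    and less: "W \<subset> U \<Longrightarrow> nullity \<Delta> W < k" "W \<subset> V \<Longrightarrow> nullity \<Delta> W < k" for W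
    using assms by (auto simp: minimal_of_nullity_def)
  have fin: "finite U" "finite V" using sub finite_subset by blast+
  have "U \<inter> V \<subset> U \<or> U \<inter> V \<subset> V" using assms(3) by auto
  then have "nullity \<Delta> (U \<inter> V) < k" using less by auto
  with nullity_supermodular[OF fin] null show ?thesis by linarith
qed

lemma finite_minimal_of_nullity: "finite (minimal_of_nullity n \<Delta> k)"
  by (rule finite_subset[of _ "Pow {1..n}"]) (auto simp: minimal_of_nullity_def)

end

section \<open>Ideals of subrings of a commutative ring\<close>

definition type_subring :: "'a::comm_ring_1 set \<Rightarrow> 'a ring" where
  "type_subring T = ring_of_type_algebra\<lparr>carrier := T\<rparr>"

locale carrier_subring =
  fixes T :: "'a::comm_ring_1 set"
  assumes one_mem: "1 \<in> T"
    and add_mem: "a \<in> T \<Longrightarrow> b \<in> T \<Longrightarrow> a + b \<in> T"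
    and uminus_mem: "a \<in> T \<Longrightarrow> - a \<in> T"
    and mult_mem: "a \<in> T \<Longrightarrow> b \<in> T \<Longrightarrow> a * b \<in> T"
begin

abbreviation R :: "'a ring" where
  "R \<equiv> type_subring T"

lemma zero_mem: "0 \<in> T"
  using add_mem[OF one_mem uminus_mem[OF one_mem]] by simp

lemma R_simps [simp]:
  "carrier R = T" "x \<oplus>\<^bsub>R\<^esub> y = x + y" "x \<otimes>\<^bsub>R\<^esub> y = x * y" "\<zero>\<^bsub>R\<^esub> = 0" "\<one>\<^bsub>R\<^esub> = 1"
  by (simp_all add: type_subring_def ring_of_type_algebra_def)

lemma cring_R: "cring R"
proof (rule cringI)
  show "abelian_group R"
    by (rule abelian_groupI)
      (auto simp: add_mem zero_mem algebra_simps intro!: bexI[OF _ uminus_mem])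
  show "Group.comm_monoid R"
    by (rule comm_monoidI) (auto simp: mult_mem one_mem algebra_simps)
qed (auto simp: algebra_simps)

lemma pow_R [simp]: "x [^]\<^bsub>R\<^esub> (k::nat) = x ^ k"
proof -
  interpret cring R by (rule cring_R)
  show ?thesis by (induction k) (auto simp: mult.commute)
qed

lemma power_mem: "a \<in> T \<Longrightarrow> a ^ k \<in> T"
  by (induction k) (auto simp: one_mem mult_mem)

lemma of_nat_mem: "of_nat k \<in> T"
  by (induction k) (auto simp: zero_mem one_mem add_mem)

lemma sum_mem: "(\<And>i. i \<in> A \<Longrightarrow> f i \<in> T) \<Longrightarrow> sum f A \<in> T"
  by (induction A rule: infinite_finite_induct) (auto simp: zero_mem add_mem)

lemma prod_mem: "(\<And>i. i \<in> A \<Longrightarrow> f i \<in> T) \<Longrightarrow> prod f A \<in> T"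
  by (induction A rule: infinite_finite_induct) (auto simp: one_mem mult_mem)

lemma ideal_R_iff:
  "ideal I R \<longleftrightarrow>
     I \<subseteq> T \<and> 0 \<in> I \<and> (\<forall>a\<in>I. \<forall>b\<in>I. a + b \<in> I) \<and> (\<forall>r\<in>T. \<forall>a\<in>I. r * a \<in> I)"
proof
  assume "ideal I R"
  then interpret ideal I R .
  show "I \<subseteq> T \<and> 0 \<in> I \<and> (\<forall>a\<in>I. \<forall>b\<in>I. a + b \<in> I) \<and> (\<forall>r\<in>T. \<forall>a\<in>I. r * a \<in> I)"
    using a_subset additive_subgroup.zero_closed[OF additive_subgroup_axioms]
      additive_subgroup.a_closed[OF additive_subgroup_axioms] I_l_closed by auto
next
  assume I: "I \<subseteq> T \<and> 0 \<in> I \<and> (\<forall>a\<in>I. \<forall>b\<in>I. a + b \<in> I) \<and> (\<forall>r\<in>T. \<forall>a\<in>I. r * a \<in> I)"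
  interpret cring R by (rule cring_R)
  have neg: "- a \<in> I" if "a \<in> I" for a
    using I that uminus_mem[OF one_mem] by (metis mult_minus1)
  have I_r: "a * r \<in> I" if "a \<in> I" "r \<in> T" for a r
    using I that by (metis mult.commute)
  have inv: "\<ominus>\<^bsub>R\<^esub> a = - a" if "a \<in> T" for a
    using that uminus_mem by (intro minus_equality) auto
  show "ideal I R"
  proof (rule idealI[OF ring_axioms])
    show "subgroup I (add_monoid R)"
    proof (rule add.subgroupI)
      show "\<ominus>\<^bsub>R\<^esub> a \<in> I" if "a \<in> I" for a
        using that I neg inv[of a] by auto
    qed (use I in auto)
  qed (use I I_r in auto)
qed

lemma
  assumes "ideal I R"
  shows ideal_mem: "a \<in> I \<Longrightarrow> a \<in> T"
    and ideal_zero: "0 \<in> I"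
    and ideal_add: "a \<in> I \<Longrightarrow> b \<in> I \<Longrightarrow> a + b \<in> I"
    and ideal_mult_left: "r \<in> T \<Longrightarrow> a \<in> I \<Longrightarrow> r * a \<in> I"
    and ideal_mult_right: "r \<in> T \<Longrightarrow> a \<in> I \<Longrightarrow> a * r \<in> I"
  using assms by (auto simp: ideal_R_iff mult.commute)

lemma ideal_sum_mem:
  assumes "ideal I R" "\<And>i. i \<in> A \<Longrightarrow> f i \<in> I"
  shows "sum f A \<in> I"
  using assms(2) by (induction A rule: infinite_finite_induct) (use assms(1) ideal_R_iff in auto)

lemma ideal_one_iff:
  assumes "ideal I R"
  shows "1 \<in> I \<longleftrightarrow> I = T"
  using assms unfolding ideal_R_iff by (metis mult.right_neutral one_mem subsetI subset_antisym)

lemma primeideal_R_iff: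
  "primeideal I R \<longleftrightarrow>
     ideal I R \<and> 1 \<notin> I \<and> (\<forall>a\<in>T. \<forall>b\<in>T. a * b \<in> I \<longrightarrow> a \<in> I \<or> b \<in> I)"
proof
  assume "primeideal I R"
  then interpret primeideal I R .
  show "ideal I R \<and> 1 \<notin> I \<and> (\<forall>a\<in>T. \<forall>b\<in>T. a * b \<in> I \<longrightarrow> a \<in> I \<or> b \<in> I)"
    using is_ideal I_notcarr I_prime ideal_one_iff[OF is_ideal] by auto
next
  assume "ideal I R \<and> 1 \<notin> I \<and> (\<forall>a\<in>T. \<forall>b\<in>T. a * b \<in> I \<longrightarrow> a \<in> I \<or> b \<in> I)"
  then show "primeideal I R"
    using ideal_one_iff by (intro primeidealI cring_R) auto
qed

lemma
  assumes "primeideal I R"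
  shows prime_ideal: "ideal I R"
    and prime_one: "1 \<notin> I"
    and prime_mult: "a \<in> T \<Longrightarrow> b \<in> T \<Longrightarrow> a * b \<in> I \<Longrightarrow> a \<in> I \<or> b \<in> I"
  using assms by (auto simp: primeideal_R_iff)

lemma prime_power_mem:
  assumes "primeideal I R" "a \<in> T" "a ^ k \<in> I"
  shows "a \<in> I"
  using assms(3)
proof (induction k)
  case 0
  then show ?case using assms(1) primeideal_R_iff by auto
next
  case (Suc k)
  then have "a \<in> I \<or> a ^ k \<in> I"
    using assms(1,2) power_mem primeideal_R_iff by auto
  then show ?case using Suc.IH by blast
qed

lemma prime_prod_mem:
  assumes "primeideal I R" "finite A" "\<And>i. i \<in> A \<Longrightarrow> f i \<in> T" "prod f A \<in> I"
  shows "\<exists>i\<in>A. f i \<in> I"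
  using assms(2-4)
proof (induction A rule: finite_induct)
  case empty
  then show ?case using assms(1) primeideal_R_iff by auto
next
  case (insert i A)
  then have "f i \<in> T" "prod f A \<in> T" "f i * prod f A \<in> I"
    by (auto intro: prod_mem)
  then have "f i \<in> I \<or> prod f A \<in> I"
    using assms(1) primeideal_R_iff by blast
  then show ?case using insert by auto
qed

lemma Idl_ideal: "G \<subseteq> T \<Longrightarrow> ideal (Idl\<^bsub>R\<^esub> G) R"
  by (simp add: ring.genideal_ideal cring.axioms(1)[OF cring_R])

lemma Idl_superset: "G \<subseteq> T \<Longrightarrow> G \<subseteq> Idl\<^bsub>R\<^esub> G"
  by (simp add: ring.genideal_self cring.axioms(1)[OF cring_R])

lemma Idl_least: "ideal I R \<Longrightarrow> G \<subseteq> I \<Longrightarrow> Idl\<^bsub>R\<^esub> G \<subseteq> I"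
  by (simp add: ring.genideal_minimal cring.axioms(1)[OF cring_R])

lemma radical_R: "radical R I = {a \<in> T. \<exists>k. a ^ k \<in> I}"
  by (simp add: radical_def)

lemma radical_superset: "ideal I R \<Longrightarrow> I \<subseteq> radical R I"
  unfolding radical_R ideal_R_iff by (auto intro: exI[of _ 1])

lemma radical_mono: "I \<subseteq> J \<Longrightarrow> radical R I \<subseteq> radical R J"
  unfolding radical_R by auto

lemma radical_power_mem: "a \<in> T \<Longrightarrow> a ^ k \<in> radical R I \<Longrightarrow> a \<in> radical R I"
  unfolding radical_R by (auto simp: power_mult[symmetric])

lemma radical_ideal:
  assumes "ideal I R"
  shows "ideal (radical R I) R"
proof -
  have I: "0 \<in> I" "\<And>r a. r \<in> T \<Longrightarrow> a \<in> I \<Longrightarrow> r * a \<in> I"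
    using assms ideal_R_iff by auto
  have "a + b \<in> radical R I" if mem: "a \<in> radical R I" "b \<in> radical R I" for a b
  proof -
    obtain k l where ab: "a \<in> T" "b \<in> T" "a ^ k \<in> I" "b ^ l \<in> I"
      using mem by (auto simp: radical_R)
    \<comment> \<open>Every term of the binomial expansion contains \<open>a ^ k\<close> or \<open>b ^ l\<close>.\<close>
    have "of_nat ((k + l) choose i) * a ^ i * b ^ (k + l - i) \<in> I" for i
    proof (cases "k \<le> i")
      case True
      then have "of_nat ((k + l) choose i) * a ^ i * b ^ (k + l - i) =
          (of_nat ((k + l) choose i) * a ^ (i - k) * b ^ (k + l - i)) * a ^ k"
        using power_add[of a "i - k" k] by (simp add: mult_ac)
      then show ?thesis
        using I(2)[OF _ ab(3)] ab by (simp add: mult_mem of_nat_mem power_mem)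
    next
      case False
      then have "of_nat ((k + l) choose i) * a ^ i * b ^ (k + l - i) =
          (of_nat ((k + l) choose i) * a ^ i * b ^ (k - i)) * b ^ l"
        using power_add[of b "k - i" l] by (simp add: mult_ac)
      then show ?thesis
        using I(2)[OF _ ab(4)] ab by (simp add: mult_mem of_nat_mem power_mem)
    qed
    then have "(a + b) ^ (k + l) \<in> I"
      unfolding binomial_ring by (intro ideal_sum_mem[OF assms])
    then show ?thesis
      using ab add_mem by (auto simp: radical_R)
  qed
  moreover have "r * a \<in> radical R I" if mem: "r \<in> T" "a \<in> radical R I" for r a
  proof -
    obtain k where "a \<in> T" "a ^ k \<in> I" using mem by (auto simp: radical_R)
    then have "(r * a) ^ k \<in> I" using mem I(2) power_mem by (simp add: power_mult_distrib)
    then show ?thesis using mem \<open>a \<in> T\<close> mult_mem by (auto simp: radical_R)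
  qed
  ultimately show ?thesis
    unfolding ideal_R_iff using zero_mem I(1) by (auto simp: radical_R intro: exI[of _ 1])
qed

lemma radical_Idl_eqI:
  assumes "ideal I R" "G \<subseteq> I" "I \<subseteq> radical R (Idl\<^bsub>R\<^esub> G)"
  shows "radical R (Idl\<^bsub>R\<^esub> G) = radical R I"
proof
  show "radical R (Idl\<^bsub>R\<^esub> G) \<subseteq> radical R I"
    using assms by (intro radical_mono Idl_least)
  show "radical R I \<subseteq> radical R (Idl\<^bsub>R\<^esub> G)"
  proof
    fix a assume "a \<in> radical R I"
    then obtain k where "a \<in> T" "a ^ k \<in> I" by (auto simp: radical_R)
    then show "a \<in> radical R (Idl\<^bsub>R\<^esub> G)"
      using assms(3) by (intro radical_power_mem[of a k]) auto
  qed
qed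

end

section \<open>Primes of a localization\<close>

locale localized_subring = carrier_subring S for S :: "'a::idom set" +
  fixes P :: "'a set"
  assumes prime_P: "primeideal P (type_subring S)"
begin

definition fractions :: "'a fract set" where
  "fractions = {Fract a b | a b. a \<in> S \<and> b \<in> S \<and> b \<notin> P}"

definition extension :: "'a set \<Rightarrow> 'a fract set" where
  "extension Q = {Fract a b | a b. a \<in> Q \<and> b \<in> S \<and> b \<notin> P}"

definition contraction :: "'a fract set \<Rightarrow> 'a set" where
  "contraction J = {a \<in> S. Fract a 1 \<in> J}"

lemma denominator_nonzero: "b \<notin> P \<Longrightarrow> b \<noteq> 0"
  using prime_P by (auto simp: primeideal_R_iff ideal_R_iff)

lemma denominator_mult: "b \<in> S \<Longrightarrow> c \<in> S \<Longrightarrow> b \<notin> P \<Longrightarrow> c \<notin> P \<Longrightarrow> b * c \<notin> P"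
  using prime_P by (auto simp: primeideal_R_iff)

lemma one_denominator: "1 \<notin> P"
  using prime_P by (auto simp: primeideal_R_iff)

lemma Fract_mem: "a \<in> S \<Longrightarrow> b \<in> S \<Longrightarrow> b \<notin> P \<Longrightarrow> Fract a b \<in> fractions"
  by (auto simp: fractions_def)

lemma Fract_one_mem: "a \<in> S \<Longrightarrow> Fract a 1 \<in> fractions"
  using one_mem one_denominator by (simp add: Fract_mem)

lemma fractionsE:
  assumes "x \<in> fractions"
  obtains a b where "x = Fract a b" "a \<in> S" "b \<in> S" "b \<notin> P" "b \<noteq> 0"
  using assms denominator_nonzero by (auto simp: fractions_def)

lemma Fract_one_eq_mult: "b \<noteq> 0 \<Longrightarrow> Fract a 1 = Fract b 1 * Fract a b" for a :: 'a
  by (simp add: eq_fract)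

sublocale loc: carrier_subring fractions
proof
  show "1 \<in> fractions"
    using Fract_one_mem[OF one_mem] by (simp add: One_fract_def)
  fix x y assume "x \<in> fractions" "y \<in> fractions"
  then obtain a b c d where *: "x = Fract a b" "a \<in> S" "b \<in> S" "b \<notin> P" "b \<noteq> 0"
    "y = Fract c d" "c \<in> S" "d \<in> S" "d \<notin> P" "d \<noteq> 0"
    by (meson fractionsE)
  then show "x + y \<in> fractions" "x * y \<in> fractions"
    using denominator_mult[of b d] by (auto intro!: Fract_mem add_mem mult_mem)
next
  fix x assume "x \<in> fractions"
  then show "- x \<in> fractions"
    by (elim fractionsE) (auto intro!: Fract_mem uminus_mem)
qed

text \<open>Denominators are units, so an ideal of the localization is determined by its numerators.\<close>

lemma Fract_mem_ideal_iff:
  assumes "ideal J loc.R" "a \<in> S" "b \<in> S" "b \<notin> P"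
  shows "Fract a b \<in> J \<longleftrightarrow> Fract a 1 \<in> J"
proof
  assume "Fract a b \<in> J"
  then have "Fract b 1 * Fract a b \<in> J"
    by (intro loc.ideal_mult_left[OF assms(1)] Fract_one_mem assms)
  then show "Fract a 1 \<in> J"
    using Fract_one_eq_mult[of b a] denominator_nonzero[OF assms(4)] by simp
next
  assume "Fract a 1 \<in> J"
  then have "Fract 1 b * Fract a 1 \<in> J"
    by (intro loc.ideal_mult_left[OF assms(1)] Fract_mem one_mem assms)
  then show "Fract a b \<in> J"
    by simp
qed

lemma contraction_ideal:
  assumes "ideal J loc.R"
  shows "ideal (contraction J) R"
proof -
  have J: "J \<subseteq> fractions" "0 \<in> J" "\<And>x y. x \<in> J \<Longrightarrow> y \<in> J \<Longrightarrow> x + y \<in> J"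
    "\<And>r x. r \<in> fractions \<Longrightarrow> x \<in> J \<Longrightarrow> r * x \<in> J"
    using assms loc.ideal_R_iff by auto
  show ?thesis
    unfolding ideal_R_iff contraction_def
    using J(2) J(3)[of "Fract _ 1" "Fract _ 1"] J(4)[of "Fract _ 1" "Fract _ 1"]
    by (auto simp: Zero_fract_def zero_mem add_mem mult_mem Fract_one_mem)
qed

lemma contraction_primeideal:
  assumes "primeideal J loc.R"
  shows "primeideal (contraction J) R"
proof -
  have "ideal J loc.R" "1 \<notin> J"
    and prime: "\<And>x y. x \<in> fractions \<Longrightarrow> y \<in> fractions \<Longrightarrow> x * y \<in> J \<Longrightarrow> x \<in> J \<or> y \<in> J"
    using assms loc.primeideal_R_iff by auto
  then show ?thesis
    unfolding primeideal_R_iff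
    using contraction_ideal prime[of "Fract _ 1" "Fract _ 1"]
    by (auto simp: contraction_def One_fract_def Fract_one_mem)
qed

lemma contraction_strict_mono:
  assumes "ideal I loc.R" "ideal J loc.R" "I \<subset> J"
  shows "contraction I \<subset> contraction J"
proof -
  obtain x where x: "x \<in> J" "x \<notin> I" using assms(3) by blast
  then have "x \<in> fractions" using loc.ideal_mem[OF assms(2)] by blast
  then obtain a b where "x = Fract a b" "a \<in> S" "b \<in> S" "b \<notin> P"
    by (rule fractionsE)
  then have "a \<in> contraction J" "a \<notin> contraction I"
    using x Fract_mem_ideal_iff assms by (auto simp: contraction_def)
  then show ?thesis using assms(3) by (auto simp: contraction_def)
qed

lemma Fract_mem_extension_iff:
  assumes "primeideal Q R" "Q \<subseteq> P" "a \<in> S" "b \<in> S" "b \<notin> P"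
  shows "Fract a b \<in> extension Q \<longleftrightarrow> a \<in> Q"
proof
  assume "Fract a b \<in> extension Q"
  then obtain c d where cd: "Fract a b = Fract c d" "c \<in> Q" "d \<in> S" "d \<notin> P"
    by (auto simp: extension_def)
  then have "a * d = c * b"
    using denominator_nonzero assms(5) by (simp add: eq_fract)
  then have "a * d \<in> Q"
    using ideal_mult_right[OF prime_ideal[OF assms(1)] assms(4) cd(2)] by simp
  then show "a \<in> Q"
    using prime_mult[OF assms(1,3) cd(3)] assms(2) cd(4) by blast
qed (use assms in \<open>auto simp: extension_def\<close>)

lemma extension_primeideal:
  assumes "primeideal Q R" "Q \<subseteq> P"
  shows "primeideal (extension Q) loc.R"
proof -
  note ideal_Q = prime_ideal[OF assms(1)]
  note Q = ideal_add[OF ideal_Q] ideal_mult_left[OF ideal_Q] ideal_mult_right[OF ideal_Q]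
    prime_mult[OF assms(1)]
  note ext_iff = Fract_mem_extension_iff[OF assms]
  have sub: "extension Q \<subseteq> fractions"
    using ideal_mem[OF ideal_Q] by (auto simp: extension_def fractions_def)
  have add: "x + y \<in> extension Q" if xy: "x \<in> extension Q" "y \<in> extension Q" for x y
  proof -
    obtain a b c d where *: "x = Fract a b" "a \<in> S" "b \<in> S" "b \<notin> P" "b \<noteq> 0"
      "y = Fract c d" "c \<in> S" "d \<in> S" "d \<notin> P" "d \<noteq> 0"
      using xy sub by (meson fractionsE subsetD)
    then have "a \<in> Q" "c \<in> Q" using xy ext_iff by auto
    then show ?thesis
      using * Q by (simp add: ext_iff add_mem mult_mem denominator_mult)
  qed
  have mult: "x * y \<in> extension Q \<longleftrightarrow> x \<in> extension Q \<or> y \<in> extension Q"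
    if xy: "x \<in> fractions" "y \<in> fractions" for x y
  proof -
    obtain a b c d where *: "x = Fract a b" "a \<in> S" "b \<in> S" "b \<notin> P"
      "y = Fract c d" "c \<in> S" "d \<in> S" "d \<notin> P"
      using xy by (meson fractionsE)
    then show ?thesis
      using Q(2,3) Q(4)[of a c] by (auto simp: ext_iff mult_mem denominator_mult)
  qed
  show ?thesis
    unfolding loc.primeideal_R_iff loc.ideal_R_iff
    using sub add mult ideal_zero[OF ideal_Q] prime_one[OF assms(1)] ext_iff[OF zero_mem one_mem one_denominator]
      ext_iff[OF one_mem one_mem one_denominator]
    by (auto simp: One_fract_def Zero_fract_def)
qed

lemma extension_strict_mono:
  assumes "primeideal Q R" "primeideal Q' R" "Q \<subset> Q'" "Q' \<subseteq> P"
  shows "extension Q \<subset> extension Q'"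
proof -
  obtain a where "a \<in> Q'" "a \<notin> Q" using assms(3) by blast
  moreover have "a \<in> S" using \<open>a \<in> Q'\<close> ideal_mem[OF prime_ideal[OF assms(2)]] by blast
  ultimately have "Fract a 1 \<in> extension Q'" "Fract a 1 \<notin> extension Q"
    using assms one_mem one_denominator by (auto simp: Fract_mem_extension_iff)
  moreover have "extension Q \<subseteq> extension Q'"
    using assms(3) unfolding extension_def by blast
  ultimately show ?thesis by blast
qed

lemma contraction_extension:
  assumes "primeideal Q R" "Q \<subseteq> P"
  shows "contraction (extension Q) = Q"
  using Fract_mem_extension_iff[OF assms _ one_mem one_denominator] ideal_mem[OF prime_ideal[OF assms(1)]]
  by (auto simp: contraction_def)

lemma extension_subset:
  assumes "ideal J loc.R" "Q \<subseteq> contraction J"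
  shows "extension Q \<subseteq> J"
  using assms Fract_mem_ideal_iff by (auto simp: extension_def contraction_def)

end

section \<open>Monomial primes of a polynomial ring\<close>

definition polynomials :: "nat \<Rightarrow> 'k::field mpoly set" where
  "polynomials n = {p. \<forall>m\<in>Poly_Mapping.keys p. Poly_Mapping.keys m \<subseteq> {1..n}}"

text \<open>The ideal generated by the variables \<open>x\<^sub>i\<close> with \<open>i \<in> A\<close>. Being generated by monomials it can be
  described by exponents, and in this form primality is easy to see.\<close>

definition variable_ideal :: "nat \<Rightarrow> nat set \<Rightarrow> 'k::field mpoly set" where
  "variable_ideal n A =
     {p \<in> polynomials n. \<forall>m\<in>Poly_Mapping.keys p. Poly_Mapping.keys m \<inter> A \<noteq> {}}"

lemma mpoly_ring_eq: "mpoly_ring n = type_subring (polynomials n)"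
  by (simp add: mpoly_ring_def type_subring_def polynomials_def)

lemma keys_add_nat: "Poly_Mapping.keys (a + b) = Poly_Mapping.keys a \<union> Poly_Mapping.keys b"
  for a b :: "'a \<Rightarrow>\<^sub>0 nat"
  by (auto simp: in_keys_iff lookup_add)

lemma keys_mult_cases:
  assumes "m \<in> Poly_Mapping.keys (p * q)"
  obtains a b where "m = a + b" "a \<in> Poly_Mapping.keys p" "b \<in> Poly_Mapping.keys q"
  using keys_mult[of p q] assms by auto

lemma keys_add_cases:
  assumes "m \<in> Poly_Mapping.keys (p + q)"
  shows "m \<in> Poly_Mapping.keys p \<or> m \<in> Poly_Mapping.keys q"
  using keys_add[of p q] assms by blast

lemma sum_monomials: "p = (\<Sum>m\<in>Poly_Mapping.keys p. Poly_Mapping.single m (Poly_Mapping.lookup p m))"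
proof (rule poly_mapping_eqI)
  fix m
  have "(\<Sum>l\<in>Poly_Mapping.keys p. Poly_Mapping.lookup (Poly_Mapping.single l (Poly_Mapping.lookup p l)) m)
      = (\<Sum>l\<in>Poly_Mapping.keys p. if l = m then Poly_Mapping.lookup p l else 0)"
    by (intro sum.cong) (auto simp: lookup_single)
  also have "\<dots> = Poly_Mapping.lookup p m"
    by (simp add: in_keys_iff)
  finally show "Poly_Mapping.lookup p m =
      Poly_Mapping.lookup (\<Sum>l\<in>Poly_Mapping.keys p. Poly_Mapping.single l (Poly_Mapping.lookup p l)) m"
    by (simp add: lookup_sum)
qed

interpretation pol: carrier_subring "polynomials n" for n
proof
  fix p q :: "'a mpoly" assume pq: "p \<in> polynomials n" "q \<in> polynomials n"
  show "p + q \<in> polynomials n"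
    using pq by (auto simp: polynomials_def dest!: keys_add_cases)
  show "p * q \<in> polynomials n"
    unfolding polynomials_def
  proof safe
    fix m i assume "m \<in> Poly_Mapping.keys (p * q)" and i: "i \<in> Poly_Mapping.keys m"
    then obtain a b where "m = a + b" "a \<in> Poly_Mapping.keys p" "b \<in> Poly_Mapping.keys q"
      by (rule_tac keys_mult_cases)
    then have "i \<in> Poly_Mapping.keys a \<union> Poly_Mapping.keys b"
      "Poly_Mapping.keys a \<subseteq> {1..n}" "Poly_Mapping.keys b \<subseteq> {1..n}"
      using i pq by (simp_all add: keys_add_nat polynomials_def)
    then show "i \<in> {1..n}"
      by blast
  qed
qed (auto simp: polynomials_def)

lemma indet_mem: "i \<in> {1..n} \<Longrightarrow> indet i \<in> polynomials n"
  by (auto simp: polynomials_def indet_def)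

lemma constant_mem: "Poly_Mapping.single 0 c \<in> polynomials n"
  by (auto simp: polynomials_def)

lemma variable_ideal_ideal: "ideal (variable_ideal n A) (pol.R n)"
  unfolding pol.ideal_R_iff
proof (intro conjI ballI)
  show "variable_ideal n A \<subseteq> polynomials n" "0 \<in> variable_ideal n A"
    by (auto simp: variable_ideal_def pol.zero_mem)
  fix p q :: "'a mpoly"
  assume p: "p \<in> variable_ideal n A"
  show "p + q \<in> variable_ideal n A" if q: "q \<in> variable_ideal n A"
    using p q by (auto simp: variable_ideal_def pol.add_mem dest!: keys_add_cases)
  show "q * p \<in> variable_ideal n A" if q: "q \<in> polynomials n"
    unfolding variable_ideal_def
  proof (intro CollectI conjI ballI)
    show "q * p \<in> polynomials n"
      using p q by (simp add: variable_ideal_def pol.mult_mem)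
    fix m assume "m \<in> Poly_Mapping.keys (q * p)"
    then obtain a b where "m = a + b" "b \<in> Poly_Mapping.keys p"
      by (rule keys_mult_cases)
    then show "Poly_Mapping.keys m \<inter> A \<noteq> {}"
      using p by (auto simp: keys_add_nat variable_ideal_def)
  qed
qed

lemma split_off_variable_ideal:
  assumes "p \<in> polynomials n" "p \<notin> variable_ideal n A"
  obtains r s where "p = r + s" "r \<in> polynomials n" "r \<noteq> 0" "s \<in> variable_ideal n A"
    "\<And>m. m \<in> Poly_Mapping.keys r \<Longrightarrow> Poly_Mapping.keys m \<inter> A = {}"
proof -
  define M where "M = {m \<in> Poly_Mapping.keys p. Poly_Mapping.keys m \<inter> A = {}}"
  define N where "N = Poly_Mapping.keys p - M"
  define part where "part = (\<lambda>M. \<Sum>m\<in>M. Poly_Mapping.single m (Poly_Mapping.lookup p m))"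
  have sub: "M \<subseteq> Poly_Mapping.keys p" "N \<subseteq> Poly_Mapping.keys p"
    by (auto simp: M_def N_def)
  have keys_part: "Poly_Mapping.keys (part M') \<subseteq> M'" if "M' \<subseteq> Poly_Mapping.keys p" for M'
    unfolding part_def using keys_sum[of _ M'] that by (fastforce split: if_splits)
  have "part M' \<in> polynomials n" if "M' \<subseteq> Poly_Mapping.keys p" for M'
    using keys_part[OF that] that assms(1) by (auto simp: polynomials_def)
  moreover have "p = part M + part N"
    using sum.subset_diff[OF sub(1), of "\<lambda>m. Poly_Mapping.single m (Poly_Mapping.lookup p m)"] sum_monomials[of p]
    by (simp add: part_def N_def add.commute)
  moreover have "part N \<in> variable_ideal n A"
    using keys_part[OF sub(2)] calculation(1)[OF sub(2)] by (auto simp: variable_ideal_def N_def M_def)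
  moreover have "part M \<noteq> 0"
    using calculation(2,3) assms(2) by auto
  moreover have "Poly_Mapping.keys m \<inter> A = {}" if "m \<in> Poly_Mapping.keys (part M)" for m
    using keys_part[OF sub(1)] that by (auto simp: M_def)
  ultimately show ?thesis
    using that[of "part M" "part N"] sub by auto
qed

text \<open>Modulo the ideal only the monomials without variables from \<open>A\<close> matter. The corresponding parts of two
  polynomials outside the ideal are nonzero, and so is their product, in which no variable from \<open>A\<close>
  occurs.\<close>

lemma variable_ideal_primeideal: "primeideal (variable_ideal n A) (pol.R n)"
  unfolding pol.primeideal_R_iff
proof (intro conjI ballI impI)
  show "ideal (variable_ideal n A) (pol.R n)"
    by (rule variable_ideal_ideal)
  show "1 \<notin> variable_ideal n A"
    by (simp add: variable_ideal_def)
  fix p q :: "'a mpoly"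
  assume pq: "p \<in> polynomials n" "q \<in> polynomials n" "p * q \<in> variable_ideal n A"
  show "p \<in> variable_ideal n A \<or> q \<in> variable_ideal n A"
  proof (rule ccontr)
    assume "\<not> ?thesis"
    then have np: "p \<notin> variable_ideal n A" "q \<notin> variable_ideal n A" by auto
    obtain r s where p: "p = r + s" "r \<in> polynomials n" "r \<noteq> 0" "s \<in> variable_ideal n A"
      "\<And>m. m \<in> Poly_Mapping.keys r \<Longrightarrow> Poly_Mapping.keys m \<inter> A = {}"
      using split_off_variable_ideal[OF pq(1) np(1)] by metis
    obtain r' s' where q: "q = r' + s'" "r' \<in> polynomials n" "r' \<noteq> 0" "s' \<in> variable_ideal n A"
      "\<And>m. m \<in> Poly_Mapping.keys r' \<Longrightarrow> Poly_Mapping.keys m \<inter> A = {}"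
      using split_off_variable_ideal[OF pq(2) np(2)] by metis
    have "r * s' \<in> variable_ideal n A" "s * q \<in> variable_ideal n A"
      using p q pq pol.ideal_mult_left[OF variable_ideal_ideal] pol.ideal_mult_right[OF variable_ideal_ideal]
      by blast+
    then have "r * s' + s * q \<in> variable_ideal n A"
      by (rule pol.ideal_add[OF variable_ideal_ideal])
    then have "(- 1) * (r * s' + s * q) \<in> variable_ideal n A"
      by (intro pol.ideal_mult_left[OF variable_ideal_ideal] pol.uminus_mem pol.one_mem)
    then have "p * q + (- 1) * (r * s' + s * q) \<in> variable_ideal n A"
      by (rule pol.ideal_add[OF variable_ideal_ideal pq(3)])
    also have "p * q + (- 1) * (r * s' + s * q) = r * r'"
      by (simp add: p(1) q(1) algebra_simps)
    finally have "r * r' \<in> variable_ideal n A" .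
    moreover have "r * r' \<noteq> 0"
      using p(3) q(3) by simp
    then obtain m where m: "m \<in> Poly_Mapping.keys (r * r')"
      by (metis all_not_in_conv keys_eq_empty)
    moreover have "Poly_Mapping.keys m \<inter> A = {}"
      using m p(5) q(5) by (elim keys_mult_cases) (auto simp: keys_add_nat)
    ultimately show False
      by (auto simp: variable_ideal_def)
  qed
qed

lemma variable_ideal_mono: "A \<subseteq> B \<Longrightarrow> variable_ideal n A \<subseteq> variable_ideal n B"
  by (auto simp: variable_ideal_def)

lemma indet_mem_variable_ideal_iff:
  "i \<in> {1..n} \<Longrightarrow> indet i \<in> variable_ideal n A \<longleftrightarrow> i \<in> A"
  by (auto simp: variable_ideal_def indet_mem) (auto simp: indet_def)

lemma variable_ideal_strict_mono:
  assumes "A \<subset> B" "B \<subseteq> {1..n}"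
  shows "(variable_ideal n A :: 'k::field mpoly set) \<subset> variable_ideal n B"
proof -
  obtain i where "i \<in> B" "i \<notin> A" using assms(1) by blast
  then have "(indet i :: 'k mpoly) \<in> variable_ideal n B" "(indet i :: 'k mpoly) \<notin> variable_ideal n A"
    using assms(2) by (auto simp: indet_mem_variable_ideal_iff subset_iff)
  then show ?thesis using variable_ideal_mono[of A B n] assms(1) by blast
qed

lemma variable_ideal_least:
  fixes I :: "'k::field mpoly set"
  assumes I: "ideal I (pol.R n)" and A: "indet ` A \<subseteq> I"
  shows "variable_ideal n A \<subseteq> I"
proof
  fix p :: "'k mpoly" assume p: "p \<in> variable_ideal n A"
  then have p': "p \<in> polynomials n" by (simp add: variable_ideal_def)
  have "Poly_Mapping.single m (Poly_Mapping.lookup p m) \<in> I" if m: "m \<in> Poly_Mapping.keys p" for m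
  proof -
    obtain i where i: "i \<in> Poly_Mapping.keys m" "i \<in> A"
      using p m by (auto simp: variable_ideal_def)
    define l where "l = m - Poly_Mapping.single i 1"
    have ml: "m = l + Poly_Mapping.single i 1"
      using i(1) by (intro poly_mapping_eqI)
        (auto simp: l_def lookup_add lookup_minus lookup_single in_keys_iff when_def)
    then have eq: "Poly_Mapping.single m (Poly_Mapping.lookup p m) =
        Poly_Mapping.single l (Poly_Mapping.lookup p m) * indet i"
      by (simp add: indet_def mult_single)
    have "Poly_Mapping.keys l \<subseteq> Poly_Mapping.keys m"
      using ml by (metis keys_add_nat Un_upper1)
    also have "\<dots> \<subseteq> {1..n}"
      using p' m by (simp add: polynomials_def)
    finally have "Poly_Mapping.keys l \<subseteq> {1..n}" .
    then have "Poly_Mapping.single l (Poly_Mapping.lookup p m) \<in> polynomials n"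
      by (auto simp: polynomials_def)
    with i(2) A show ?thesis
      unfolding eq by (intro pol.ideal_mult_left[OF I]) auto
  qed
  then show "p \<in> I"
    by (subst sum_monomials) (intro pol.ideal_sum_mem[OF I])
qed

lemma irrelevant_ideal_eq: "irrelevant_ideal n = variable_ideal n {1..n}"
proof
  have sub: "indet ` {1..n} \<subseteq> polynomials n" by (auto intro: indet_mem)
  show "irrelevant_ideal n \<subseteq> variable_ideal n {1..n}"
    unfolding irrelevant_ideal_def mpoly_ring_eq
    by (intro pol.Idl_least variable_ideal_ideal) (auto simp: indet_mem_variable_ideal_iff)
  show "variable_ideal n {1..n} \<subseteq> irrelevant_ideal n"
    unfolding irrelevant_ideal_def mpoly_ring_eq
    by (intro variable_ideal_least pol.Idl_ideal pol.Idl_superset sub)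
qed

lemma prod_indet_mem: "F \<subseteq> {1..n} \<Longrightarrow> (\<Prod>i\<in>F. indet i) \<in> polynomials n"
  by (intro pol.prod_mem indet_mem) auto

section \<open>The dimension of a polynomial ring\<close>

definition power_product :: "(nat \<Rightarrow> 'a) \<Rightarrow> nat list \<Rightarrow> 'a::comm_monoid_mult" where
  "power_product y \<alpha> = (\<Prod>i<length \<alpha>. y i ^ (\<alpha> ! i))"

lemma power_product_simps [simp]:
  "power_product y [] = 1"
  "power_product y (a # \<alpha>) = y 0 ^ a * power_product (\<lambda>i. y (Suc i)) \<alpha>"
  unfolding power_product_def
  by (simp_all add: prod.lessThan_Suc_shift del: prod.lessThan_Suc)

context carrier_subring
begin

lemma power_product_mem:
  "(\<And>i. i < length \<alpha> \<Longrightarrow> y i \<in> T) \<Longrightarrow> power_product y \<alpha> \<in> T"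
  unfolding power_product_def by (intro prod_mem power_mem) auto

text \<open>Let \<open>P\<^sub>0 \<subseteq> \<dots> \<subseteq> P\<^sub>k\<close> be primes and \<open>y\<^sub>i\<close> an element of \<open>P\<^sub>i\<^sub>+\<^sub>1\<close> outside \<open>P\<^sub>i\<close>. In a polynomial relation
  among the \<open>y\<^sub>i\<close> the lowest power of \<open>y\<^sub>0\<close> can be cancelled modulo \<open>P\<^sub>0\<close>. The terms that still contain
  \<open>y\<^sub>0\<close> then lie in \<open>P\<^sub>1\<close>, and the other ones form a relation modulo \<open>P\<^sub>1\<close> among \<open>y\<^sub>1, \<dots>, y\<^sub>k\<^sub>-\<^sub>1\<close>. After \<open>k\<close>
  such steps nothing but a coefficient is left.\<close>

lemma relation_coefficient_in_prime:
  assumes "\<And>i. i \<le> k \<Longrightarrow> primeideal (P i) R"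
    and "\<And>i. i < k \<Longrightarrow> P i \<subseteq> P (Suc i)"
    and "\<And>i. i < k \<Longrightarrow> y i \<in> P (Suc i) \<and> y i \<notin> P i"
    and "finite E" "E \<noteq> {}"
    and "\<And>\<alpha>. \<alpha> \<in> E \<Longrightarrow> length \<alpha> = k"
    and "\<And>\<alpha>. \<alpha> \<in> E \<Longrightarrow> c \<alpha> \<in> T"
    and "(\<Sum>\<alpha>\<in>E. c \<alpha> * power_product y \<alpha>) \<in> P 0"
  shows "\<exists>\<alpha>\<in>E. c \<alpha> \<in> P k"
  using assms
proof (induction k arbitrary: P y E c)
  case 0
  then have "E = {[]}" by auto
  with 0 show ?case by simp
next
  case (Suc k)
  note primeP = Suc.prems(1) and chainP = Suc.prems(2) and y = Suc.prems(3)
  note finE = Suc.prems(4) and lenE = Suc.prems(6) and cE = Suc.prems(7)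
  have ideal0: "ideal (P 0) R" and ideal1: "ideal (P (Suc 0)) R"
    using primeP[of 0] primeP[of "Suc 0"] prime_ideal by auto
  have y_mem: "y i \<in> T" if "i < Suc k" for i
    using ideal_mem[OF prime_ideal[OF primeP[of "Suc i"]]] y[of i] that by auto
  define y' where "y' = (\<lambda>i. y (Suc i))"
  define a where "a = Min (hd ` E)"
  define E0 where "E0 = {\<beta>. a # \<beta> \<in> E}"
  define g where "g = (\<lambda>\<alpha>. c \<alpha> * (y 0 ^ (hd \<alpha> - a) * power_product y' (tl \<alpha>)))"
  have Cons: "\<alpha> = hd \<alpha> # tl \<alpha>" if "\<alpha> \<in> E" for \<alpha>
    using lenE[OF that] by (cases \<alpha>) auto
  have a_le: "a \<le> hd \<alpha>" if "\<alpha> \<in> E" for \<alpha>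
    unfolding a_def using finE that by auto
  have "a \<in> hd ` E"
    unfolding a_def using finE Suc.prems(5) by (intro Min_in) auto
  then obtain \<alpha>0 where "\<alpha>0 \<in> E" "hd \<alpha>0 = a" by auto
  then have E0_ne: "E0 \<noteq> {}"
    unfolding E0_def using Cons[of \<alpha>0] by (metis empty_iff mem_Collect_eq)
  have E0_image: "(#) a ` E0 = {\<alpha> \<in> E. hd \<alpha> = a}"
    using Cons by (force simp: E0_def)
  have "finite ((#) a ` E0)"
    unfolding E0_image using finE by simp
  then have finE0: "finite E0"
    by (rule finite_imageD) simp
  have g_mem: "g \<alpha> \<in> T" if "\<alpha> \<in> E" for \<alpha>
    unfolding g_def y'_def using that lenE[OF that] cE y_mem
    by (intro mult_mem power_mem power_product_mem) auto
  \<comment> \<open>Dividing by the lowest power of the first element, which is outside the prime.\<close>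
  have "c \<alpha> * power_product y \<alpha> = y 0 ^ a * g \<alpha>" if "\<alpha> \<in> E" for \<alpha>
  proof -
    have "power_product y \<alpha> = y 0 ^ hd \<alpha> * power_product y' (tl \<alpha>)"
      by (subst Cons[OF that]) (simp add: y'_def)
    also have "y 0 ^ hd \<alpha> = y 0 ^ a * y 0 ^ (hd \<alpha> - a)"
      using a_le[OF that] by (simp flip: power_add)
    finally show ?thesis by (simp add: g_def mult_ac)
  qed
  then have "(\<Sum>\<alpha>\<in>E. c \<alpha> * power_product y \<alpha>) = y 0 ^ a * sum g E"
    by (simp add: sum_distrib_left)
  then have "y 0 ^ a * sum g E \<in> P 0"
    using Suc.prems(8) by simp
  moreover have "y 0 ^ a \<notin> P 0"
    using prime_power_mem[OF primeP[of 0] y_mem[of 0]] y[of 0] by auto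
  ultimately have "sum g E \<in> P 0"
    using prime_mult[OF primeP[of 0]] power_mem y_mem[of 0] sum_mem[of E g] g_mem by blast
  then have sum_g: "sum g E \<in> P (Suc 0)"
    using chainP[of 0] by auto
  have "g \<alpha> \<in> P (Suc 0)" if "\<alpha> \<in> E" "hd \<alpha> \<noteq> a" for \<alpha>
  proof -
    have "hd \<alpha> - a = Suc (hd \<alpha> - a - 1)"
      using a_le[OF that(1)] that(2) by simp
    then have "g \<alpha> = (c \<alpha> * (y 0 ^ (hd \<alpha> - a - 1) * power_product y' (tl \<alpha>))) * y 0"
      unfolding g_def by (metis (no_types, lifting) mult.assoc mult.commute power_Suc)
    also have "\<dots> \<in> P (Suc 0)"
      unfolding y'_def using that lenE[OF that(1)] cE y_mem y[of 0]
      by (intro ideal_mult_left[OF ideal1] mult_mem power_mem power_product_mem) auto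
    finally show ?thesis .
  qed
  then have rest: "sum g {\<alpha> \<in> E. hd \<alpha> \<noteq> a} \<in> P (Suc 0)"
    by (intro ideal_sum_mem[OF ideal1]) auto
  have "E - {\<alpha> \<in> E. hd \<alpha> = a} = {\<alpha> \<in> E. hd \<alpha> \<noteq> a}" by auto
  then have split: "sum g E = sum g {\<alpha> \<in> E. hd \<alpha> \<noteq> a} + sum g {\<alpha> \<in> E. hd \<alpha> = a}"
    using sum.subset_diff[of "{\<alpha> \<in> E. hd \<alpha> = a}" E g] finE by simp
  have "sum g E + (- 1) * sum g {\<alpha> \<in> E. hd \<alpha> \<noteq> a} \<in> P (Suc 0)"
    using ideal_add[OF ideal1 sum_g ideal_mult_left[OF ideal1 uminus_mem[OF one_mem] rest]] .
  then have "sum g {\<alpha> \<in> E. hd \<alpha> = a} \<in> P (Suc 0)"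
    by (simp add: split)
  also have "sum g {\<alpha> \<in> E. hd \<alpha> = a} = (\<Sum>\<beta>\<in>E0. c (a # \<beta>) * power_product y' \<beta>)"
    unfolding E0_image[symmetric] by (subst sum.reindex) (auto simp: g_def)
  finally have sum_E0: "(\<Sum>\<beta>\<in>E0. c (a # \<beta>) * power_product y' \<beta>) \<in> P (Suc 0)" .
  have "\<exists>\<beta>\<in>E0. c (a # \<beta>) \<in> P (Suc k)"
  proof (rule Suc.IH[of "\<lambda>i. P (Suc i)" y' E0 "\<lambda>\<beta>. c (a # \<beta>)"])
    show "length \<beta> = k" "c (a # \<beta>) \<in> T" if "\<beta> \<in> E0" for \<beta>
      using that lenE[of "a # \<beta>"] cE by (auto simp: E0_def)
  qed (use primeP chainP y finE0 E0_ne sum_E0 in \<open>simp_all add: y'_def\<close>)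
  then show ?case by (auto simp: E0_def)
qed

end

text \<open>Pigeonhole principle of linear algebra, for families instead of sets of vectors.\<close>

lemma linear_dependence:
  fixes v :: "'i \<Rightarrow> ('m::comm_monoid_add \<Rightarrow>\<^sub>0 'k::field)"
  assumes "finite E" "finite M" "\<And>\<alpha>. \<alpha> \<in> E \<Longrightarrow> Poly_Mapping.keys (v \<alpha>) \<subseteq> M" "card M < card E"
  shows "\<exists>c. (\<exists>\<alpha>\<in>E. c \<alpha> \<noteq> 0) \<and> (\<Sum>\<alpha>\<in>E. Poly_Mapping.single 0 (c \<alpha>) * v \<alpha>) = 0"
proof (cases "inj_on v E")
  case True
  interpret vector_space "\<lambda>(c::'k) (p::'m \<Rightarrow>\<^sub>0 'k). Poly_Mapping.single 0 c * p"
    by unfold_locales (auto simp: algebra_simps single_add mult_single)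
  have "v \<alpha> \<in> span ((\<lambda>m. Poly_Mapping.single m 1) ` M)" if "\<alpha> \<in> E" for \<alpha>
  proof -
    have "Poly_Mapping.single 0 (Poly_Mapping.lookup (v \<alpha>) m) * Poly_Mapping.single m 1
        \<in> span ((\<lambda>m. Poly_Mapping.single m 1) ` M)" if "m \<in> Poly_Mapping.keys (v \<alpha>)" for m
      using that assms(3)[OF \<open>\<alpha> \<in> E\<close>] by (intro span_scale span_base) auto
    then show ?thesis
      by (subst sum_monomials) (intro span_sum, simp add: mult_single)
  qed
  then have "v ` E \<subseteq> span ((\<lambda>m. Poly_Mapping.single m 1) ` M)"
    by auto
  moreover have "card ((\<lambda>m. Poly_Mapping.single m (1::'k)) ` M) < card (v ` E)"
    using card_image_le[OF assms(2)] card_image[OF True] assms(4) by (metis le_less_trans)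
  ultimately have "dependent (v ` E)"
    using independent_span_bound[of "(\<lambda>m. Poly_Mapping.single m 1) ` M" "v ` E"] assms(2)
    by (metis finite_imageI not_less)
  then obtain u where u: "\<exists>w\<in>v ` E. u w \<noteq> 0" "(\<Sum>w\<in>v ` E. Poly_Mapping.single 0 (u w) * w) = 0"
    using dependent_finite[of "v ` E"] assms(1) by auto
  then show ?thesis
    using True by (intro exI[of _ "u \<circ> v"]) (auto simp: sum.reindex)
next
  case False
  then obtain \<alpha> \<beta> where ab: "\<alpha> \<in> E" "\<beta> \<in> E" "\<alpha> \<noteq> \<beta>" "v \<alpha> = v \<beta>"
    by (auto simp: inj_on_def)
  define c :: "'i \<Rightarrow> 'k" where "c = (\<lambda>_. 0)(\<alpha> := 1, \<beta> := - 1)"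
  have "(\<Sum>\<gamma>\<in>E. Poly_Mapping.single 0 (c \<gamma>) * v \<gamma>) = (\<Sum>\<gamma>\<in>{\<alpha>, \<beta>}. Poly_Mapping.single 0 (c \<gamma>) * v \<gamma>)"
    using assms(1) ab by (intro sum.mono_neutral_right) (auto simp: c_def)
  also have "\<dots> = 0"
    using ab by (simp add: c_def single_uminus)
  finally show ?thesis
    using ab by (intro exI[of _ c]) (auto simp: c_def)
qed

definition exponent_box :: "nat \<Rightarrow> nat \<Rightarrow> (nat \<Rightarrow>\<^sub>0 nat) set" where
  "exponent_box n B = {m. Poly_Mapping.keys m \<subseteq> {1..n} \<and> (\<forall>i. Poly_Mapping.lookup m i \<le> B)}"

lemma exponent_box_card: "finite (exponent_box n B)" "card (exponent_box n B) \<le> (B + 1) ^ n"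
proof -
  define L where "L = {xs. set xs \<subseteq> {..B} \<and> length xs = n}"
  define f where "f = (\<lambda>m :: nat \<Rightarrow>\<^sub>0 nat. map (Poly_Mapping.lookup m) [1..<Suc n])"
  have L: "finite L" "card L = (B + 1) ^ n"
    unfolding L_def by (simp_all add: finite_lists_length_eq card_lists_length_eq)
  have sub: "f ` exponent_box n B \<subseteq> L"
    by (auto simp: f_def L_def exponent_box_def)
  have inj: "inj_on f (exponent_box n B)"
  proof (intro inj_onI poly_mapping_eqI)
    fix l m i assume lm: "l \<in> exponent_box n B" "m \<in> exponent_box n B" "f l = f m"
    show "Poly_Mapping.lookup l i = Poly_Mapping.lookup m i"
    proof (cases "i \<in> {1..n}")
      case True
      then show ?thesis using lm(3) by (auto simp: f_def)
    next
      case False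
      then have "i \<notin> Poly_Mapping.keys l" "i \<notin> Poly_Mapping.keys m"
        using lm(1,2) unfolding exponent_box_def by blast+
      then show ?thesis by (simp add: in_keys_iff)
    qed
  qed
  show "finite (exponent_box n B)"
    using inj_on_finite[OF inj sub L(1)] .
  show "card (exponent_box n B) \<le> (B + 1) ^ n"
    using card_inj_on_le[OF inj sub L(1)] L(2) by simp
qed

lemma exponent_box_mono: "B \<le> C \<Longrightarrow> exponent_box n B \<subseteq> exponent_box n C"
  by (auto simp: exponent_box_def intro: le_trans)

lemma keys_mult_exponent_box:
  assumes "Poly_Mapping.keys p \<subseteq> exponent_box n B" "Poly_Mapping.keys q \<subseteq> exponent_box n C"
  shows "Poly_Mapping.keys (p * q) \<subseteq> exponent_box n (B + C)"
proof
  fix m assume "m \<in> Poly_Mapping.keys (p * q)"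
  then obtain a b where "m = a + b" "a \<in> exponent_box n B" "b \<in> exponent_box n C"
    using assms by (elim keys_mult_cases) auto
  then show "m \<in> exponent_box n (B + C)"
    by (simp add: exponent_box_def keys_add_nat lookup_add add_mono)
qed

lemma keys_one_exponent_box: "Poly_Mapping.keys (1::'k::field mpoly) \<subseteq> exponent_box n B"
  by (simp add: exponent_box_def)

lemma keys_power_exponent_box:
  fixes p :: "'k::field mpoly"
  assumes "Poly_Mapping.keys p \<subseteq> exponent_box n B"
  shows "Poly_Mapping.keys (p ^ a) \<subseteq> exponent_box n (a * B)"
  by (induction a) (use keys_one_exponent_box keys_mult_exponent_box[OF assms] in auto)

lemma keys_power_product_exponent_box:
  fixes y :: "nat \<Rightarrow> 'k::field mpoly"
  assumes "\<And>i. i < length \<alpha> \<Longrightarrow> Poly_Mapping.keys (y i) \<subseteq> exponent_box n D" "set \<alpha> \<subseteq> {..N}"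
  shows "Poly_Mapping.keys (power_product y \<alpha>) \<subseteq> exponent_box n (length \<alpha> * (N * D))"
  using assms
proof (induction \<alpha> arbitrary: y)
  case Nil
  then show ?case using keys_one_exponent_box by simp
next
  case (Cons a \<alpha>)
  have "Poly_Mapping.keys (y 0 ^ a) \<subseteq> exponent_box n (a * D)"
    using Cons.prems(1)[of 0] by (intro keys_power_exponent_box) auto
  also have "\<dots> \<subseteq> exponent_box n (N * D)"
    using Cons.prems(2) by (intro exponent_box_mono) auto
  finally have *: "Poly_Mapping.keys (y 0 ^ a) \<subseteq> exponent_box n (N * D)" .
  have "Poly_Mapping.keys (power_product (\<lambda>i. y (Suc i)) \<alpha>) \<subseteq> exponent_box n (length \<alpha> * (N * D))"
    using Cons.prems by (intro Cons.IH) auto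
  from keys_mult_exponent_box[OF * this] show ?case
    by simp
qed

lemma polynomials_exponent_box:
  assumes "p \<in> polynomials n"
  shows "\<exists>D. Poly_Mapping.keys p \<subseteq> exponent_box n D"
proof -
  define D where "D = (\<Sum>m\<in>Poly_Mapping.keys p. \<Sum>i\<in>Poly_Mapping.keys m. Poly_Mapping.lookup m i)"
  have "Poly_Mapping.lookup m i \<le> D" if m: "m \<in> Poly_Mapping.keys p" for m i
  proof (cases "i \<in> Poly_Mapping.keys m")
    case True
    then have "Poly_Mapping.lookup m i \<le> (\<Sum>i\<in>Poly_Mapping.keys m. Poly_Mapping.lookup m i)"
      by (intro member_le_sum) auto
    also have "\<dots> \<le> D"
      unfolding D_def using m by (intro member_le_sum) auto
    finally show ?thesis .
  qed (simp add: in_keys_iff)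
  then show ?thesis
    using assms by (intro exI[of _ D]) (auto simp: exponent_box_def polynomials_def)
qed

text \<open>There are \<open>(N + 1) ^ (n + 1)\<close> power products of \<open>n + 1\<close> given polynomials with exponents up to \<open>N\<close>.
  The exponents of their monomials grow linearly with \<open>N\<close>, so they lie in a space whose dimension is
  bounded by a polynomial of degree \<open>n\<close> in \<open>N\<close>, and for large \<open>N\<close> they are linearly dependent.\<close>

lemma algebraic_dependence:
  fixes y :: "nat \<Rightarrow> 'k::field mpoly"
  assumes "\<And>i. i < Suc n \<Longrightarrow> y i \<in> polynomials n"
  obtains E c where "finite E" "E \<noteq> {}" "\<And>\<alpha>. \<alpha> \<in> E \<Longrightarrow> length \<alpha> = Suc n" "\<And>\<alpha>. \<alpha> \<in> E \<Longrightarrow> c \<alpha> \<noteq> 0"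
    "(\<Sum>\<alpha>\<in>E. Poly_Mapping.single 0 (c \<alpha>) * power_product y \<alpha>) = 0"
proof -
  have "\<forall>i\<in>{..<Suc n}. \<exists>D. Poly_Mapping.keys (y i) \<subseteq> exponent_box n D"
    using assms polynomials_exponent_box by auto
  then obtain d where d: "\<And>i. i < Suc n \<Longrightarrow> Poly_Mapping.keys (y i) \<subseteq> exponent_box n (d i)"
    by (metis lessThan_iff)
  define D where "D = (\<Sum>i<Suc n. d i)"
  have D: "Poly_Mapping.keys (y i) \<subseteq> exponent_box n D" if "i < Suc n" for i
    using d[OF that] exponent_box_mono[of "d i" D n] that member_le_sum[of i "{..<Suc n}" d]
    by (auto simp: D_def)
  \<comment> \<open>The dimension is at most \<open>((Suc n * D + 1) * (N + 1)) ^ n = N * (N + 1) ^ n\<close> for this choice.\<close>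
  define N where "N = (Suc n * D + 1) ^ n"
  define M where "M = exponent_box n (Suc n * (N * D))"
  define L where "L = {\<alpha>. set \<alpha> \<subseteq> {..N} \<and> length \<alpha> = Suc n}"
  have "finite L" and card_L: "card L = (N + 1) ^ Suc n"
    unfolding L_def by (simp_all add: finite_lists_length_eq card_lists_length_eq del: power_Suc)
  have "card M \<le> (Suc n * (N * D) + 1) ^ n"
    unfolding M_def by (rule exponent_box_card)
  also have "\<dots> \<le> ((Suc n * D + 1) * (N + 1)) ^ n"
    by (intro power_mono) (auto simp: algebra_simps)
  also have "\<dots> = N * (N + 1) ^ n"
    by (simp only: power_mult_distrib N_def)
  also have "\<dots> < card L"
    unfolding card_L by simp
  finally have "card M < card L" .
  moreover have "Poly_Mapping.keys (power_product y \<alpha>) \<subseteq> M" if "\<alpha> \<in> L" for \<alpha>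
    using keys_power_product_exponent_box[of \<alpha> y n D N] D that by (auto simp: L_def M_def)
  moreover have "finite M"
    unfolding M_def by (rule exponent_box_card)
  ultimately obtain c where c: "\<exists>\<alpha>\<in>L. c \<alpha> \<noteq> 0"
    "(\<Sum>\<alpha>\<in>L. Poly_Mapping.single 0 (c \<alpha>) * power_product y \<alpha>) = 0"
    using linear_dependence[OF \<open>finite L\<close>, of M "power_product y"] by metis
  have "(\<Sum>\<alpha>\<in>{\<alpha>\<in>L. c \<alpha> \<noteq> 0}. Poly_Mapping.single 0 (c \<alpha>) * power_product y \<alpha>) = 0"
    unfolding c(2)[symmetric] using \<open>finite L\<close> by (intro sum.mono_neutral_left) auto
  moreover have "finite {\<alpha>\<in>L. c \<alpha> \<noteq> 0}"
    by (rule finite_subset[OF _ \<open>finite L\<close>]) auto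
  moreover have "{\<alpha>\<in>L. c \<alpha> \<noteq> 0} \<noteq> {}"
    "\<And>\<alpha>. \<alpha> \<in> {\<alpha>\<in>L. c \<alpha> \<noteq> 0} \<Longrightarrow> length \<alpha> = Suc n"
    using c(1) by (auto simp: L_def)
  ultimately show ?thesis
    using that[of "{\<alpha>\<in>L. c \<alpha> \<noteq> 0}" c] by blast
qed

text \<open>The dimension of the polynomial ring is at most \<open>n\<close>: a chain that is one step longer would, by
  algebraic dependence, contain a nonzero constant in one of its primes.\<close>

lemma polynomials_chain_length:
  fixes P :: "nat \<Rightarrow> 'k::field mpoly set"
  assumes "\<And>i. i \<le> m \<Longrightarrow> primeideal (P i) (pol.R n)" "\<And>i. i < m \<Longrightarrow> P i \<subset> P (Suc i)"
  shows "m \<le> n"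
proof (rule ccontr)
  assume "\<not> m \<le> n"
  then have prime: "primeideal (P i) (pol.R n)" if "i \<le> Suc n" for i
    using that assms(1) by auto
  have "\<forall>i\<in>{..<Suc n}. \<exists>z. z \<in> P (Suc i) \<and> z \<notin> P i"
  proof
    fix i assume "i \<in> {..<Suc n}"
    then have "P i \<subset> P (Suc i)"
      using assms(2)[of i] \<open>\<not> m \<le> n\<close> by simp
    then show "\<exists>z. z \<in> P (Suc i) \<and> z \<notin> P i"
      by blast
  qed
  then obtain y where y: "\<And>i. i < Suc n \<Longrightarrow> y i \<in> P (Suc i) \<and> y i \<notin> P i"
    by (metis lessThan_iff)
  have y_mem: "y i \<in> polynomials n" if "i < Suc n" for i
    using y[OF that] pol.ideal_mem[OF pol.prime_ideal[OF prime[of "Suc i"]]] that by auto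
  obtain E c where E: "finite E" "E \<noteq> {}" "\<And>\<alpha>. \<alpha> \<in> E \<Longrightarrow> length \<alpha> = Suc n"
    "\<And>\<alpha>. \<alpha> \<in> E \<Longrightarrow> c \<alpha> \<noteq> 0"
    "(\<Sum>\<alpha>\<in>E. Poly_Mapping.single 0 (c \<alpha>) * power_product y \<alpha>) = 0"
  proof (rule algebraic_dependence[of n y])
    show "y i \<in> polynomials n" if "i < Suc n" for i
      using y_mem[OF that] .
  qed (rule that)
  have "\<exists>\<alpha>\<in>E. Poly_Mapping.single 0 (c \<alpha>) \<in> P (Suc n)"
  proof (rule pol.relation_coefficient_in_prime[where k = "Suc n" and P = P and y = y and E = E
        and c = "\<lambda>\<alpha>. Poly_Mapping.single 0 (c \<alpha>)"])
    show "primeideal (P i) (pol.R n)" if "i \<le> Suc n" for i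
      using prime[OF that] .
    show "P i \<subseteq> P (Suc i)" if "i < Suc n" for i
      using assms(2)[of i] that \<open>\<not> m \<le> n\<close> by auto
    show "(\<Sum>\<alpha>\<in>E. Poly_Mapping.single 0 (c \<alpha>) * power_product y \<alpha>) \<in> P 0"
      using E(5) pol.ideal_zero[OF pol.prime_ideal[OF prime[of 0]]] by simp
  qed (use y E(1-3) constant_mem in simp_all)
  then obtain \<alpha> where a: "\<alpha> \<in> E" "Poly_Mapping.single 0 (c \<alpha>) \<in> P (Suc n)" by auto
  have "Poly_Mapping.single 0 (inverse (c \<alpha>)) * Poly_Mapping.single 0 (c \<alpha>) \<in> P (Suc n)"
    by (intro pol.ideal_mult_left[OF pol.prime_ideal[OF prime[of "Suc n"]]] constant_mem a) simp
  then show False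
    using E(4)[OF a(1)] pol.prime_one[OF prime[of "Suc n"]] by (simp add: mult_single)
qed

(* Keeps {1..n} from being rewritten to {Suc 0..n}. *)
declare One_nat_def [simp del]

section \<open>Generators of the Stanley-Reisner ideal up to radical\<close>

interpretation mloc: localized_subring "polynomials n" "irrelevant_ideal n" for n
  by (intro localized_subring.intro pol.carrier_subring_axioms localized_subring_axioms.intro)
    (simp only: irrelevant_ideal_eq variable_ideal_primeideal)

lemma localization_eq:
  "localization_at (mpoly_ring n) (irrelevant_ideal n) = mloc.loc.R n"
  by (simp only: localization_at_def mpoly_ring_eq pol.R_simps mloc.fractions_def)
    (simp only: type_subring_def)

lemma variable_ideal_irrelevant: "A \<subseteq> {1..n} \<Longrightarrow> variable_ideal n A \<subseteq> irrelevant_ideal n"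
  unfolding irrelevant_ideal_eq by (rule variable_ideal_mono)

lemma Fract_one_power: "Fract a 1 ^ k = Fract (a ^ k) 1" for a :: "'a::idom"
  by (induction k) (simp_all add: One_fract_def)

lemma exhausting_chain:
  assumes "finite C"
  obtains B where "B 0 = {}" "B (card C) = C" "\<And>j. j < card C \<Longrightarrow> B j \<subset> B (Suc j)"
    "\<And>j. j \<le> card C \<Longrightarrow> B j \<subseteq> C"
proof -
  obtain f where f: "bij_betw f {0..<card C} C"
    using ex_bij_betw_nat_finite[OF assms] by blast
  have img: "f ` {0..<card C} = C" and inj: "inj_on f {0..<card C}"
    using f by (auto simp: bij_betw_def)
  show ?thesis
  proof (rule that[of "\<lambda>j. f ` {0..<j}"])
    show "f ` {0..<j} \<subset> f ` {0..<Suc j}" if "j < card C" for j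
    proof (rule image_strict_mono)
      show "inj_on f {0..<Suc j}"
        using inj that by (auto intro: inj_on_subset)
    qed (auto simp: psubset_eq set_eq_iff)
    show "f ` {0..<j} \<subseteq> C" if "j \<le> card C" for j
    proof -
      have "f ` {0..<j} \<subseteq> f ` {0..<card C}"
        using that by (intro image_mono) auto
      then show ?thesis by (simp only: img)
    qed
  qed (simp_all add: img)
qed

abbreviation vertex_monomial :: "nat set \<Rightarrow> 'k::field mpoly" where
  "vertex_monomial A \<equiv> \<Prod>i\<in>A. indet i"

context matroid
begin

definition nullity_sum :: "nat \<Rightarrow> 'k::field mpoly" where
  "nullity_sum k = (\<Sum>U\<in>minimal_of_nullity n \<Delta> k. vertex_monomial U)"

lemma nullity_sum_mem: "nullity_sum k \<in> polynomials n"
  unfolding nullity_sum_def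
  by (intro pol.sum_mem prod_indet_mem) (auto simp: minimal_of_nullity_def)

lemma stanley_reisner_generators:
  "{vertex_monomial F | F. F \<subseteq> {1..n} \<and> F \<notin> \<Delta>} \<subseteq> (polynomials n :: 'k::field mpoly set)"
  using prod_indet_mem by blast

lemma stanley_reisner_ideal: "ideal (stanley_reisner_ideal n \<Delta> :: 'k::field mpoly set) (pol.R n)"
  unfolding stanley_reisner_ideal_def mpoly_ring_eq
  by (rule pol.Idl_ideal[OF stanley_reisner_generators])

lemma nonface_mem_stanley_reisner:
  assumes "F \<subseteq> {1..n}" "F \<notin> \<Delta>"
  shows "(vertex_monomial F :: 'k::field mpoly) \<in> stanley_reisner_ideal n \<Delta>"
  using pol.Idl_superset[OF stanley_reisner_generators] assms
  unfolding stanley_reisner_ideal_def mpoly_ring_eq by blast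

lemma stanley_reisner_least:
  fixes I :: "'k::field mpoly set"
  assumes "ideal I (pol.R n)" "\<And>F. F \<subseteq> {1..n} \<Longrightarrow> F \<notin> \<Delta> \<Longrightarrow> vertex_monomial F \<in> I"
  shows "stanley_reisner_ideal n \<Delta> \<subseteq> I"
  unfolding stanley_reisner_ideal_def mpoly_ring_eq
  by (rule pol.Idl_least[OF assms(1)]) (use assms(2) in auto)

lemma nullity_sum_mem_stanley_reisner:
  assumes "0 < k"
  shows "(nullity_sum k :: 'k::field mpoly) \<in> stanley_reisner_ideal n \<Delta>"
  unfolding nullity_sum_def
proof (rule pol.ideal_sum_mem[OF stanley_reisner_ideal])
  fix U assume "U \<in> minimal_of_nullity n \<Delta> k"
  then have "U \<subseteq> {1..n}" "0 < nullity \<Delta> U"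
    using assms by (auto simp: minimal_of_nullity_def)
  then show "(vertex_monomial U :: 'k mpoly) \<in> stanley_reisner_ideal n \<Delta>"
    using nullity_pos_iff[of U] finite_subset[of U "{1..n}"]
    by (intro nonface_mem_stanley_reisner) auto
qed

text \<open>Multiplying the sum \<open>q\<close> over all minimal sets of nullity \<open>k\<close> by the monomial of one of them, \<open>U\<close>, gives
  the square of this monomial and products of the monomials of \<open>U\<close> and \<open>V \<noteq> U\<close>. Such a product is a
  multiple of the monomial of \<open>U \<union> V\<close>, whose nullity is larger than \<open>k\<close>, so induction from the largest
  nullity downwards applies to it. A set of nullity \<open>k\<close> contains a minimal one.\<close>

lemma nonface_mem_radical:
  fixes J :: "'k::field mpoly set"
  assumes J: "ideal J (pol.R n)" "nullity_sum ` {1..nullity \<Delta> {1..n}} \<subseteq> J"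
    and "A \<subseteq> {1..n}" "0 < nullity \<Delta> A"
  shows "vertex_monomial A \<in> radical (pol.R n) J"
  using assms(3,4)
proof (induction "nullity \<Delta> {1..n} - nullity \<Delta> A" arbitrary: A rule: less_induct)
  case less
  let ?x = "vertex_monomial :: nat set \<Rightarrow> 'k mpoly"
  let ?rad = "radical (pol.R n) J"
  define k where "k = nullity \<Delta> A"
  have rad: "ideal ?rad (pol.R n)" by (rule pol.radical_ideal[OF J(1)])
  obtain U where U: "U \<in> minimal_of_nullity n \<Delta> k" "U \<subseteq> A"
    unfolding k_def using contains_minimal_of_nullity[OF less.prems(1)] .
  have finA: "finite A" using less.prems(1) finite_subset by blast
  have finU: "finite U" using U(2) finA finite_subset by blast
  have Usub: "U \<subseteq> {1..n}" using U(2) less.prems(1) by blast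
  have "k \<le> nullity \<Delta> {1..n}"
    unfolding k_def using less.prems(1) by (intro nullity_mono) auto
  then have "nullity_sum k \<in> J"
    using J(2) less.prems(2) by (auto simp: k_def)
  then have q: "nullity_sum k * ?x U \<in> ?rad"
    using pol.radical_superset[OF J(1)] pol.ideal_mult_right[OF rad prod_indet_mem[OF Usub]] by blast
  have "?x V * ?x U \<in> ?rad" if V: "V \<in> minimal_of_nullity n \<Delta> k - {U}" for V
  proof -
    have Vsub: "V \<subseteq> {1..n}" using V by (auto simp: minimal_of_nullity_def)
    then have finV: "finite V" using finite_subset by blast
    have null: "k < nullity \<Delta> (V \<union> U)"
      using nullity_union_minimal[of V k U] V U(1) by auto
    have "nullity \<Delta> (V \<union> U) \<le> nullity \<Delta> {1..n}"
      using Vsub Usub by (intro nullity_mono) auto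
    then have "?x (V \<union> U) \<in> ?rad"
      using null Vsub Usub by (intro less.hyps) (auto simp: k_def)
    moreover have "?x (V \<inter> U) \<in> polynomials n"
      using Vsub by (intro prod_indet_mem) auto
    ultimately have "?x (V \<union> U) * ?x (V \<inter> U) \<in> ?rad"
      using pol.ideal_mult_right[OF rad] by blast
    also have "?x (V \<union> U) * ?x (V \<inter> U) = ?x V * ?x U"
      by (rule prod.union_inter[OF finV finU])
    finally show ?thesis .
  qed
  then have rest: "(\<Sum>V\<in>minimal_of_nullity n \<Delta> k - {U}. ?x V * ?x U) \<in> ?rad"
    by (intro pol.ideal_sum_mem[OF rad])
  have "nullity_sum k * ?x U = ?x U * ?x U + (\<Sum>V\<in>minimal_of_nullity n \<Delta> k - {U}. ?x V * ?x U)"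
    unfolding nullity_sum_def sum_distrib_right
    by (rule sum.remove[OF finite_minimal_of_nullity U(1)])
  then have "?x U ^ 2 = nullity_sum k * ?x U + (- 1) * (\<Sum>V\<in>minimal_of_nullity n \<Delta> k - {U}. ?x V * ?x U)"
    by (simp add: power2_eq_square)
  also have "\<dots> \<in> ?rad"
    by (rule pol.ideal_add[OF rad q pol.ideal_mult_left[OF rad pol.uminus_mem[OF pol.one_mem] rest]])
  finally have "?x U \<in> ?rad"
    by (rule pol.radical_power_mem[OF prod_indet_mem[OF Usub]])
  moreover have "?x (A - U) \<in> polynomials n"
    using less.prems(1) by (intro prod_indet_mem) auto
  ultimately have "?x (A - U) * ?x U \<in> ?rad"
    using pol.ideal_mult_left[OF rad] by blast
  also have "?x (A - U) * ?x U = ?x A"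
    by (rule prod.subset_diff[OF U(2) finA, symmetric])
  finally show ?case .
qed

lemma radical_extended:
  defines "I \<equiv> stanley_reisner_ideal n \<Delta> :: 'k::field mpoly set"
    and "L \<equiv> mloc.loc.R n :: 'k mpoly fract ring"
    and "f \<equiv> \<lambda>k. Fract (nullity_sum k :: 'k mpoly) 1"
  shows "radical L (Idl\<^bsub>L\<^esub> (f ` {1..nullity \<Delta> {1..n}})) = radical L (Idl\<^bsub>L\<^esub> ((\<lambda>a. Fract a 1) ` I))"
proof -
  let ?G = "f ` {1..nullity \<Delta> {1..n}}"
  let ?J = "mloc.contraction n (Idl\<^bsub>L\<^esub> ?G)"
  have I: "I \<subseteq> polynomials n"
    unfolding I_def using pol.ideal_mem[OF stanley_reisner_ideal] by blast
  have gensI: "(\<lambda>a. Fract a 1) ` I \<subseteq> mloc.fractions n"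
    using I mloc.Fract_one_mem by blast
  have gensG: "?G \<subseteq> mloc.fractions n"
    unfolding f_def by (auto intro: mloc.Fract_one_mem nullity_sum_mem)
  have idealG: "ideal (Idl\<^bsub>L\<^esub> ?G) L"
    unfolding L_def by (rule mloc.loc.Idl_ideal[OF gensG])
  have J: "ideal ?J (pol.R n)"
    using idealG unfolding L_def by (rule mloc.contraction_ideal)
  have "nullity_sum ` {1..nullity \<Delta> {1..n}} \<subseteq> ?J"
    using mloc.loc.Idl_superset[OF gensG] nullity_sum_mem
    unfolding L_def mloc.contraction_def by (auto simp: f_def)
  then have "I \<subseteq> radical (pol.R n) ?J"
    unfolding I_def
    by (intro stanley_reisner_least pol.radical_ideal J nonface_mem_radical)
      (auto simp: nullity_pos_iff finite_subset)
  then have "(\<lambda>a. Fract a 1) ` I \<subseteq> radical L (Idl\<^bsub>L\<^esub> ?G)"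
  proof safe
    fix a assume "a \<in> I" "I \<subseteq> radical (pol.R n) ?J"
    then obtain k where "a \<in> polynomials n" "a ^ k \<in> ?J"
      by (auto simp: pol.radical_R)
    then show "Fract a 1 \<in> radical L (Idl\<^bsub>L\<^esub> ?G)"
      unfolding L_def mloc.loc.radical_R
      using mloc.Fract_one_mem by (auto simp: mloc.contraction_def Fract_one_power)
  qed
  then have rad: "Idl\<^bsub>L\<^esub> ((\<lambda>a. Fract a 1) ` I) \<subseteq> radical L (Idl\<^bsub>L\<^esub> ?G)"
    using idealG unfolding L_def by (intro mloc.loc.Idl_least mloc.loc.radical_ideal)
  show ?thesis
    unfolding L_def
  proof (rule mloc.loc.radical_Idl_eqI)
    show "ideal (Idl\<^bsub>mloc.loc.R n\<^esub> ((\<lambda>a. Fract a 1) ` I)) (mloc.loc.R n)"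
      by (rule mloc.loc.Idl_ideal[OF gensI])
    show "?G \<subseteq> Idl\<^bsub>mloc.loc.R n\<^esub> ((\<lambda>a. Fract a 1) ` I)"
    proof
      fix x assume "x \<in> ?G"
      then obtain k where k: "1 \<le> k" "x = Fract (nullity_sum k) 1"
        by (auto simp: f_def)
      then have "nullity_sum k \<in> I"
        unfolding I_def by (intro nullity_sum_mem_stanley_reisner) simp
      then have "x \<in> (\<lambda>a. Fract a 1) ` I"
        unfolding k(2) by (rule imageI)
      then show "x \<in> Idl\<^bsub>mloc.loc.R n\<^esub> ((\<lambda>a. Fract a 1) ` I)"
        using mloc.loc.Idl_superset[OF gensI] by blast
    qed
  qed (use rad in \<open>simp only: L_def\<close>)
qed

section \<open>The height of the Stanley-Reisner ideal\<close>

lemma stanley_reisner_subset_variable_ideal: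
  assumes "F \<in> facets \<Delta>"
  shows "(stanley_reisner_ideal n \<Delta> :: 'k::field mpoly set) \<subseteq> variable_ideal n ({1..n} - F)"
proof (rule stanley_reisner_least[OF variable_ideal_ideal])
  fix G assume G: "G \<subseteq> {1..n}" "G \<notin> \<Delta>"
  then obtain i where i: "i \<in> G" "i \<notin> F"
    using assms facet_face face_mono by blast
  have "finite G" using G(1) finite_subset by blast
  then have "vertex_monomial G = vertex_monomial (G - {i}) * (indet i :: 'k mpoly)"
    using i(1) by (simp add: prod.remove mult.commute)
  also have "\<dots> \<in> variable_ideal n ({1..n} - F)"
    using i G(1) by (intro pol.ideal_mult_left[OF variable_ideal_ideal] prod_indet_mem)
      (auto simp: indet_mem_variable_ideal_iff)
  finally show "(vertex_monomial G :: 'k mpoly) \<in> variable_ideal n ({1..n} - F)" .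
qed

text \<open>The variables outside a prime that contains the Stanley-Reisner ideal form a face, since the product
  of the variables of a nonface belongs to the prime. Hence the minimal primes are the ideals generated
  by the variables outside a facet.\<close>

lemma prime_contains_variable_ideal:
  fixes Q :: "'k::field mpoly set"
  assumes "primeideal Q (pol.R n)" "stanley_reisner_ideal n \<Delta> \<subseteq> Q"
  obtains F where "F \<in> facets \<Delta>" "variable_ideal n ({1..n} - F) \<subseteq> Q"
proof -
  define W where "W = {i \<in> {1..n}. (indet i :: 'k mpoly) \<notin> Q}"
  have W: "finite W" "W \<subseteq> {1..n}" by (auto simp: W_def)
  have "W \<in> \<Delta>"
  proof (rule ccontr)
    assume "W \<notin> \<Delta>"
    then have "(vertex_monomial W :: 'k mpoly) \<in> Q"
      using nonface_mem_stanley_reisner[OF W(2)] assms(2) by blast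
    moreover have "(indet i :: 'k mpoly) \<in> polynomials n" if "i \<in> W" for i
      using W(2) that indet_mem by blast
    ultimately have "\<exists>i\<in>W. (indet i :: 'k mpoly) \<in> Q"
      by (intro pol.prime_prod_mem[OF assms(1) W(1)])
    then show False by (auto simp: W_def)
  qed
  then obtain F where F: "F \<in> facets \<Delta>" "W \<subseteq> F"
    by (rule face_in_facet)
  have "variable_ideal n ({1..n} - F) \<subseteq> Q"
    using F(2) by (intro variable_ideal_least pol.prime_ideal[OF assms(1)]) (auto simp: W_def)
  with F(1) show ?thesis by (rule that)
qed

text \<open>Adding the variables one at a time gives a chain of primes below \<open>Q\<close>.\<close>

lemma prime_height_ge:
  fixes Q :: "'k::field mpoly fract set"
  assumes Q: "primeideal Q (mloc.loc.R n)" and C: "C \<subseteq> {1..n}"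
    and sub: "variable_ideal n C \<subseteq> mloc.contraction n Q"
  shows "enat (card C) \<le> prime_height (mloc.loc.R n) Q"
proof -
  have "finite C" using C finite_subset by blast
  then obtain B where B: "B 0 = {}" "B (card C) = C" "\<And>j. j < card C \<Longrightarrow> B j \<subset> B (Suc j)"
    "\<And>j. j \<le> card C \<Longrightarrow> B j \<subseteq> C"
    by (rule exhausting_chain) blast
  define E :: "nat \<Rightarrow> 'k mpoly fract set" where "E = (\<lambda>j. mloc.extension n (variable_ideal n (B j)))"
  define c where "c = (\<lambda>j. if j < card C then E j else Q)"
  have vsub: "variable_ideal n (B j) \<subseteq> irrelevant_ideal n" if "j \<le> card C" for j
    using B(4)[OF that] C by (intro variable_ideal_irrelevant) auto
  have strict: "E j \<subset> E (Suc j)" if "j < card C" for j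
    unfolding E_def
    using that B(3)[OF that] B(4)[of "Suc j"] C
    by (intro mloc.extension_strict_mono variable_ideal_primeideal variable_ideal_strict_mono vsub) auto
  have "E (card C) \<subseteq> Q"
    unfolding E_def B(2) by (rule mloc.extension_subset[OF mloc.loc.prime_ideal[OF Q] sub])
  then have "c j \<subset> c (Suc j)" if "j < card C" for j
    using strict[OF that] that by (cases "Suc j = card C") (auto simp: c_def)
  moreover have "primeideal (c j) (mloc.loc.R n)" for j
    using Q by (auto simp: c_def E_def intro!: mloc.extension_primeideal variable_ideal_primeideal vsub)
  moreover have "c (card C) = Q"
    by (simp add: c_def)
  ultimately have "\<exists>c. (\<forall>i\<le>card C. primeideal (c i) (mloc.loc.R n)) \<and>
      (\<forall>i<card C. c i \<subset> c (Suc i)) \<and> c (card C) = Q"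
    by blast
  then show ?thesis
    unfolding prime_height_def by (intro Sup_upper) blast
qed

text \<open>A chain of primes that ends at the ideal of the variables in \<open>C\<close> can be continued by adding the
  other \<open>n - card C\<close> variables one at a time, and the longer chain has at most \<open>n\<close> steps.\<close>

lemma prime_height_le:
  assumes C: "C \<subseteq> {1..n}"
  shows "prime_height (mloc.loc.R n) (mloc.extension n (variable_ideal n C :: 'k::field mpoly set))
    \<le> enat (card C)"
  unfolding prime_height_def
proof (rule Sup_least, clarify)
  fix m and c :: "nat \<Rightarrow> 'k mpoly fract set"
  assume c: "\<forall>i\<le>m. primeideal (c i) (mloc.loc.R n)" "\<forall>i<m. c i \<subset> c (Suc i)"
    "c m = mloc.extension n (variable_ideal n C)"
  define D where "D = {1..n} - C"
  have card_D: "card D = n - card C" "card C \<le> n"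
    using C card_mono[OF _ C] finite_subset[OF C] by (auto simp: D_def card_Diff_subset)
  have "finite D" by (simp add: D_def)
  then obtain B where B: "B 0 = {}" "B (card D) = D" "\<And>j. j < card D \<Longrightarrow> B j \<subset> B (Suc j)"
    "\<And>j. j \<le> card D \<Longrightarrow> B j \<subseteq> D"
    by (rule exhausting_chain) blast
  define p where "p = (\<lambda>i. if i \<le> m then mloc.contraction n (c i) else variable_ideal n (C \<union> B (i - m)))"
  have pm: "mloc.contraction n (c m) = variable_ideal n (C \<union> B 0)"
    unfolding c(3) B(1) using C
    by (simp add: mloc.contraction_extension variable_ideal_primeideal variable_ideal_irrelevant)
  have "m + card D \<le> n"
  proof (rule polynomials_chain_length[of "m + card D" p])
    fix i assume "i \<le> m + card D"
    then show "primeideal (p i) (pol.R n)"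
      using c(1) by (auto simp: p_def intro: mloc.contraction_primeideal variable_ideal_primeideal)
  next
    fix i assume i: "i < m + card D"
    show "p i \<subset> p (Suc i)"
    proof (cases "i < m")
      case True
      then have "primeideal (c i) (mloc.loc.R n)" "primeideal (c (Suc i)) (mloc.loc.R n)" "c i \<subset> c (Suc i)"
        using c(1,2) by simp_all
      then have "mloc.contraction n (c i) \<subset> mloc.contraction n (c (Suc i))"
        by (intro mloc.contraction_strict_mono mloc.loc.prime_ideal)
      then show ?thesis
        using True by (simp add: p_def)
    next
      case False
      then have "p i = variable_ideal n (C \<union> B (i - m))" "p (Suc i) = variable_ideal n (C \<union> B (Suc (i - m)))"
        using pm by (auto simp: p_def Suc_diff_le)
      moreover have "B (i - m) \<subset> B (Suc (i - m))" "B (Suc (i - m)) \<subseteq> D"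
        using i False by (auto intro!: B(3,4))
      then have "C \<union> B (i - m) \<subset> C \<union> B (Suc (i - m))" "C \<union> B (Suc (i - m)) \<subseteq> {1..n}"
        using C unfolding D_def by blast+
      ultimately show ?thesis
        using variable_ideal_strict_mono by metis
    qed
  qed
  then show "enat m \<le> enat (card C)"
    using card_D by simp
qed

text \<open>All facets have the same size, so the bounds for the heights of the primes above the ideal agree, no
  matter which facet they come from.\<close>

lemma ideal_height_extended:
  assumes "F \<in> facets \<Delta>"
  defines "I \<equiv> stanley_reisner_ideal n \<Delta> :: 'k::field mpoly set"
  shows "ideal_height (mloc.loc.R n) (Idl\<^bsub>mloc.loc.R n\<^esub> ((\<lambda>a. Fract a 1) ` I))
    = enat (card ({1..n} - F))"
proof (rule antisym)
  let ?L = "mloc.loc.R n :: 'k mpoly fract ring"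
  let ?I = "Idl\<^bsub>?L\<^esub> ((\<lambda>a. Fract a 1) ` I)"
  have I: "I \<subseteq> polynomials n"
    unfolding I_def using pol.ideal_mem[OF stanley_reisner_ideal] by blast
  have gens: "(\<lambda>a. Fract a 1) ` I \<subseteq> mloc.fractions n"
    using I mloc.Fract_one_mem by blast
  let ?Q = "mloc.extension n (variable_ideal n ({1..n} - F)) :: 'k mpoly fract set"
  have Q: "primeideal ?Q ?L"
    by (intro mloc.extension_primeideal variable_ideal_primeideal variable_ideal_irrelevant) auto
  have "(\<lambda>a. Fract a 1) ` I \<subseteq> ?Q"
    using stanley_reisner_subset_variable_ideal[OF assms(1)] mloc.one_denominator pol.one_mem
    unfolding I_def mloc.extension_def by blast
  then have "?I \<subseteq> ?Q"
    by (intro mloc.loc.Idl_least mloc.loc.prime_ideal[OF Q])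
  then have "ideal_height ?L ?I \<le> prime_height ?L ?Q"
    unfolding ideal_height_def using Q by (intro Inf_lower) auto
  also have "\<dots> \<le> enat (card ({1..n} - F))"
    by (rule prime_height_le) auto
  finally show "ideal_height ?L ?I \<le> enat (card ({1..n} - F))" .
  show "enat (card ({1..n} - F)) \<le> ideal_height ?L ?I"
    unfolding ideal_height_def
  proof (rule Inf_greatest, clarify)
    fix P assume P: "primeideal P ?L" "?I \<subseteq> P"
    have "I \<subseteq> mloc.contraction n P"
      using mloc.loc.Idl_superset[OF gens] P(2) I by (auto simp: mloc.contraction_def)
    then obtain G where G: "G \<in> facets \<Delta>" "variable_ideal n ({1..n} - G) \<subseteq> mloc.contraction n P"
      using prime_contains_variable_ideal[OF mloc.contraction_primeideal[OF P(1)]]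
      unfolding I_def by blast
    have "enat (card ({1..n} - G)) \<le> prime_height ?L P"
      by (rule prime_height_ge[OF P(1) _ G(2)]) auto
    then show "enat (card ({1..n} - F)) \<le> prime_height ?L P"
      using nullity_ground[OF G(1)] nullity_ground[OF assms(1)] by simp
  qed
qed

end

theorem corollary2p9:
  fixes n :: nat and \<Delta> :: "nat set set"
  assumes "infinite (UNIV :: 'k::field set)"
    and "n \<ge> 1"
    and "matroid_on n \<Delta>"
  shows "set_theoretic_complete_intersection
           (localization_at (mpoly_ring n :: 'k mpoly ring) (irrelevant_ideal n))
           (extended_ideal (mpoly_ring n) (irrelevant_ideal n) (stanley_reisner_ideal n \<Delta>))"
proof -
  interpret matroid n \<Delta>
    by unfold_locales (rule assms(3))
  obtain F where F: "F \<in> facets \<Delta>"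
    using facets_nonempty by blast
  have "(\<lambda>a. Fract a 1) ` stanley_reisner_ideal n \<Delta> \<subseteq> (mloc.fractions n :: 'k mpoly fract set)"
    using mloc.Fract_one_mem pol.ideal_mem[OF stanley_reisner_ideal] by blast
  moreover have "(\<lambda>k. Fract (nullity_sum k) 1) ` {1..nullity \<Delta> {1..n}} \<subseteq> (mloc.fractions n :: 'k mpoly fract set)"
    by (auto intro: mloc.Fract_one_mem nullity_sum_mem)
  ultimately show ?thesis
    unfolding set_theoretic_complete_intersection_def extended_ideal_def localization_eq
    using ideal_height_extended[OF F, symmetric] nullity_ground[OF F] radical_extended
    by (intro conjI mloc.loc.Idl_ideal exI[of _ "nullity \<Delta> {1..n}"]
        exI[of _ "\<lambda>k. Fract (nullity_sum k) 1"]) simp_all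
qed

end
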